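(* Let the smoothness parameters $\alpha>\frac12$, $\beta\le0$, $\gamma\ge0$ with $\alpha+\beta>\max\{\gamma,\frac12\}$, the dimension $d\in\mathbb{N}$, $d\ge2$, and the refinement $R\ge1$ be given. Assume that $\Lambda(\boldsymbol z,M)$ is a reconstructing rank-1 lattice for $H_R^{d,0}$. Then $$M^{-(\alpha+\beta-\gamma)/2}\lesssim\big\|\mathrm{Id}-S_{H_R^{d,0}}^{\Lambda(\boldsymbol z,M)}\big|\mathcal{H}^{\alpha,\beta}(\mathbb{T}^d)\to\mathcal{H}^{\gamma}_{\mathrm{mix}}(\mathbb{T}^d)\big\|\lesssim 2^{-(\alpha+\beta-\gamma)R}\begin{cases}R^{(d-1)/2}&:\ \beta=0,\\1&:\ \beta<0.\end{cases}$$ If $\Lambda(\boldsymbol z,M)$ is constructed by the CBC strategy, then the chain of estimates continues: the right-hand side above is $$\lesssim M^{-(\alpha+\beta-\gamma)/2}(\log M)^{\frac{d-2}{2}(\alpha+\beta-\gamma)}\begin{cases}(\log M)^{(d-1)/2}&:\ \beta=0,\\1&:\ \beta<0.\end{cases}$$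
   Context: $\mathbb{T}=[0,1)$ is the torus, $\hat f_{\boldsymbol k}=\int_{\mathbb{T}^d}f(\boldsymbol x)e^{-2\pi i\boldsymbol k\cdot\boldsymbol x}\,d\boldsymbol x$. For real $\alpha,\beta$, $\mathcal{H}^{\alpha,\beta}(\mathbb{T}^d)$ is the space of $f\in L_2(\mathbb{T}^d)$ with finite norm $$\|f|\mathcal{H}^{\alpha,\beta}(\mathbb{T}^d)\|^2=\sum_{\boldsymbol k\in\mathbb{Z}^d}|\hat f_{\boldsymbol k}|^2(1+\|\boldsymbol k\|_2^2)^{\beta}\prod_{s=1}^d(1+|k_s|^2)^{\alpha},$$ and $\mathcal{H}^{\gamma}_{\mathrm{mix}}(\mathbb{T}^d):=\mathcal{H}^{\gamma,0}(\mathbb{T}^d)$. Under the hypotheses elements of $\mathcal{H}^{\alpha,\beta}(\mathbb{T}^d)$ are continuous (after choosing the continuous representative). Hyperbolic cross: $Q_0=\{-1,0,1\}$, $Q_j=([-2^j,-2^{j-1}-1]\cup[2^{j-1}+1,2^j])\cap\mathbb{Z}$ for $j\ge1$, $Q_{\boldsymbol j}=Q_{j_1}\times\dots\times Q_{j_d}$, $J_R^{d,0}=\{\boldsymbol j\in\mathbb{N}_0^d:\|\boldsymbol j\|_1\le R+d-1\}$, $H_R^{d,0}=\bigcup_{\boldsymbol j\in J_R^{d,0}}Q_{\boldsymbol j}$. For $\boldsymbol z\in\mathbb{Z}^d$, $M\in\mathbb{N}$, the rank-1 lattice with generating vector $\boldsymbol z$ and size $M$ is $\Lambda(\boldsymbol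 z,M)=\{\frac jM\boldsymbol z\bmod\boldsymbol 1:j=0,\dots,M-1\}$. For finite $I\subset\mathbb{Z}^d$ the sampling operator is $$S_I^{\Lambda(\boldsymbol z,M)}f=\sum_{\boldsymbol k\in I}\hat f_{\boldsymbol k}^{\Lambda(\boldsymbol z,M)}e^{2\pi i\boldsymbol k\cdot\circ},\qquad \hat f_{\boldsymbol k}^{\Lambda(\boldsymbol z,M)}=\frac1M\sum_{j=0}^{M-1}f\big(\tfrac jM\boldsymbol z\big)e^{-2\pi i\frac jM\boldsymbol k\cdot\boldsymbol z}.$$ $\Lambda(\boldsymbol z,M)$ is a reconstructing rank-1 lattice for $I$ if $S_I^{\Lambda(\boldsymbol z,M)}p=p$ for all trigonometric polynomials $p$ with frequencies in $I$; equivalently $\boldsymbol k^1\cdot\boldsymbol z\not\equiv\boldsymbol k^2\cdot\boldsymbol z\pmod M$ for all distinct $\boldsymbol k^1,\boldsymbol k^2\in I$. The CBC (component-by-component) strategy is the search algorithm of Table 3.1 in L. Kämmerer's dissertation: it constructs the generating vector $\boldsymbol z$ of a reconstructing rank-1 lattice component by component, iteratively increasing the dimension of the index set for which the reconstruction property should hold. With it one can explicitly construct reconstructing rank-1 lattices for $H_R^{d,0}$ of size $2^{2R-2}\le M\lesssim 2^{2R}R^{d-2}$. $\|A|X\to Y\|$ is the operator norm; $a\lesssim b$ means $a\le c\,b$ with a constant $c>0$ independent of $R,\boldsymbol z,M$. *)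

theory Defs
  imports "HOL-Analysis.Analysis"
begin

section \<open>Functions on the torus and their Fourier coefficients\<close>

text \<open>
  A function on the \<open>d\<close>-dimensional torus is a function on \<open>real ^ 'n\<close>, where \<open>d = CARD('n)\<close>,
  that is 1-periodic in every coordinate.
\<close>

definition periodic1 :: "(real ^ 'n \<Rightarrow> complex) \<Rightarrow> bool" where
  "periodic1 f \<longleftrightarrow> (\<forall>x. \<forall>m :: int ^ 'n. f (x + (\<chi> i. of_int (m $ i))) = f x)"

definition unit_cube :: "(real ^ 'n) set" where
  "unit_cube = {x. \<forall>i. 0 \<le> x $ i \<and> x $ i < 1}"

definition fdot :: "int ^ 'n \<Rightarrow> real ^ 'n \<Rightarrow> real" where
  "fdot k x = (\<Sum>i\<in>UNIV. of_int (k $ i) * x $ i)"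

definition fourier_coeff :: "(real ^ 'n \<Rightarrow> complex) \<Rightarrow> int ^ 'n \<Rightarrow> complex" where
  "fourier_coeff f k = (LINT x:unit_cube|lborel. f x * cis (- 2 * pi * fdot k x))"

definition L2_torus :: "(real ^ 'n \<Rightarrow> complex) set" where
  "L2_torus = {f. periodic1 f \<and> f \<in> borel_measurable borel
                \<and> set_integrable lborel unit_cube (\<lambda>x. (cmod (f x))\<^sup>2)}"


section \<open>Spaces of hybrid mixed smoothness\<close>

definition hweight :: "real \<Rightarrow> real \<Rightarrow> int ^ 'n \<Rightarrow> real" where
  "hweight \<alpha> \<beta> k = (1 + (\<Sum>i\<in>UNIV. (real_of_int (k $ i))\<^sup>2)) powr \<beta>
                     * (\<Prod>i\<in>UNIV. (1 + (real_of_int (k $ i))\<^sup>2) powr \<alpha>)"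

definition hspace :: "real \<Rightarrow> real \<Rightarrow> (real ^ 'n \<Rightarrow> complex) set" where
  "hspace \<alpha> \<beta> = {f \<in> L2_torus. (\<lambda>k. (cmod (fourier_coeff f k))\<^sup>2 * hweight \<alpha> \<beta> k) summable_on UNIV}"

text \<open>The norm takes the value \<open>\<infinity>\<close> outside the space.\<close>

definition hnorm :: "real \<Rightarrow> real \<Rightarrow> (real ^ 'n \<Rightarrow> complex) \<Rightarrow> ennreal" where
  "hnorm \<alpha> \<beta> f =
     (if f \<in> hspace \<alpha> \<beta>
      then ennreal (sqrt (\<Sum>\<^sub>\<infinity>k\<in>UNIV. (cmod (fourier_coeff f k))\<^sup>2 * hweight \<alpha> \<beta> k))
      else \<infinity>)"

abbreviation hmix_norm :: "real \<Rightarrow> (real ^ 'n \<Rightarrow> complex) \<Rightarrow> ennreal" where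
  "hmix_norm \<gamma> \<equiv> hnorm \<gamma> 0"

text \<open>
  Operators that sample their argument need point values, so the elements of the space are given
  by their continuous representatives.
\<close>

definition hspace_cont :: "real \<Rightarrow> real \<Rightarrow> (real ^ 'n \<Rightarrow> complex) set" where
  "hspace_cont \<alpha> \<beta> = {f \<in> hspace \<alpha> \<beta>. continuous_on UNIV f}"

text \<open>
  The norm of an operator \<open>A\<close> defined on \<open>X\<close>. It is extended-valued: a finite bound on it includes
  that \<open>A\<close> maps the unit ball of \<open>X\<close> into the set where \<open>nY\<close> is finite.
\<close>

definition op_norm :: "'f set \<Rightarrow> ('f \<Rightarrow> ennreal) \<Rightarrow> ('g \<Rightarrow> ennreal) \<Rightarrow> ('f \<Rightarrow> 'g) \<Rightarrow> ennreal" where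
  "op_norm X nX nY A = (SUP f\<in>{f \<in> X. nX f \<le> 1}. nY (A f))"


section \<open>Hyperbolic crosses\<close>

definition dyadic_block :: "nat \<Rightarrow> int set" where
  "dyadic_block j = (if j = 0 then {-1, 0, 1}
                     else {- (2 ^ j) .. - (2 ^ (j - 1)) - 1} \<union> {2 ^ (j - 1) + 1 .. 2 ^ j})"

definition hc_levels :: "real \<Rightarrow> (nat ^ 'n) set" where
  "hc_levels R = {j. real (\<Sum>i\<in>UNIV. j $ i) \<le> R + real CARD('n) - 1}"

definition hyp_cross :: "real \<Rightarrow> (int ^ 'n) set" where
  "hyp_cross R = (\<Union>j\<in>hc_levels R. {k. \<forall>i. k $ i \<in> dyadic_block (j $ i)})"


section \<open>Sampling along rank-1 lattices\<close>

text \<open>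
  A rank-1 lattice is given by its generating vector \<open>z\<close> and its size \<open>M\<close>. The nodes are not
  reduced modulo 1, which makes no difference for periodic functions.
\<close>

definition lattice_node :: "int ^ 'n \<Rightarrow> nat \<Rightarrow> nat \<Rightarrow> real ^ 'n" where
  "lattice_node z M j = (\<chi> i. real j / real M * of_int (z $ i))"

definition lattice_coeff ::
    "int ^ 'n \<Rightarrow> nat \<Rightarrow> (real ^ 'n \<Rightarrow> complex) \<Rightarrow> int ^ 'n \<Rightarrow> complex" where
  "lattice_coeff z M f k =
     (\<Sum>j<M. f (lattice_node z M j) * cis (- 2 * pi * fdot k (lattice_node z M j))) / of_nat M"

definition trig_poly ::
    "(int ^ 'n) set \<Rightarrow> (int ^ 'n \<Rightarrow> complex) \<Rightarrow> real ^ 'n \<Rightarrow> complex" where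
  "trig_poly I c x = (\<Sum>k\<in>I. c k * cis (2 * pi * fdot k x))"

definition sampling_op ::
    "(int ^ 'n) set \<Rightarrow> int ^ 'n \<Rightarrow> nat \<Rightarrow> (real ^ 'n \<Rightarrow> complex) \<Rightarrow> real ^ 'n \<Rightarrow> complex" where
  "sampling_op I z M f = trig_poly I (lattice_coeff z M f)"

definition reconstructing :: "(int ^ 'n) set \<Rightarrow> int ^ 'n \<Rightarrow> nat \<Rightarrow> bool" where
  "reconstructing I z M \<longleftrightarrow>
     M > 0 \<and> (\<forall>c. sampling_op I z M (trig_poly I c) = trig_poly I c)"

definition sampling_error :: "real \<Rightarrow> real \<Rightarrow> real \<Rightarrow> real \<Rightarrow> int ^ 'n \<Rightarrow> nat \<Rightarrow> ennreal" where
  "sampling_error \<alpha> \<beta> \<gamma> R z M =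
     op_norm (hspace_cont \<alpha> \<beta>) (hnorm \<alpha> \<beta>) (hmix_norm \<gamma>)
       (\<lambda>f x. f x - sampling_op (hyp_cross R) z M f x)"


section \<open>Component-by-component search\<close>

text \<open>
  The projection of an index set to the coordinates in \<open>S\<close>. Dropped coordinates are set to 0, so
  that all dimensions up to \<open>d\<close> live in one type; the corresponding components of the generating
  vector are then irrelevant.
\<close>

definition proj_index :: "'n set \<Rightarrow> int ^ 'n \<Rightarrow> int ^ 'n" where
  "proj_index S k = (\<chi> i. if i \<in> S then k $ i else 0)"

text \<open>
  One run of the search for a given size \<open>M\<close>: \<open>S\<close> is the set of coordinates treated so far. In each
  step one component \<open>c\<close> between 0 and \<open>M - 1\<close> is searched for such that the extended vector is
  reconstructing for the index set projected to the extended set of coordinates. The order of the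
  coordinates and the choice among several suitable \<open>c\<close> are left open.
\<close>

inductive cbc_search :: "(int ^ 'n) set \<Rightarrow> nat \<Rightarrow> 'n set \<Rightarrow> int ^ 'n \<Rightarrow> bool"
  for I :: "(int ^ 'n) set" and M :: nat where
  start: "cbc_search I M {} 0"
| step: "cbc_search I M S z \<Longrightarrow> s \<notin> S \<Longrightarrow> 0 \<le> c \<Longrightarrow> c < int M
    \<Longrightarrow> z' = (\<chi> i. if i = s then c else z $ i)
    \<Longrightarrow> reconstructing (proj_index (insert s S) ` I) z' M
    \<Longrightarrow> cbc_search I M (insert s S) z'"

definition difference_set :: "(int ^ 'n) set \<Rightarrow> (int ^ 'n) set" where
  "difference_set I = {k - l | k l. k \<in> I \<and> l \<in> I}"

text \<open>
  The search alone does not bound \<open>M\<close> from above: it succeeds for every sufficiently large prime.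
  The strategy runs it with sizes proportional to the cardinality of the difference set. Each
  nonzero pair of opposite differences excludes at most one candidate for the next component
  modulo a prime \<open>M\<close> that divides none of the nonzero entries of the differences, so that such
  primes above half of this cardinality suffice. The factor \<open>K\<close> leaves the precise choice of the
  size open; in estimates it is a fixed constant, like the dimension. Sizes that
  are not prime are included, since \<open>M\<close> may be decreased after \<open>z\<close> has been found.
\<close>

definition cbc_constructed :: "real \<Rightarrow> (int ^ 'n) set \<Rightarrow> int ^ 'n \<Rightarrow> nat \<Rightarrow> bool" where
  "cbc_constructed K I z M \<longleftrightarrow>
     cbc_search I M UNIV z \<and> real M \<le> K * real (card (difference_set I))"

end

theory Submission
  imports Defs
begin

text \<open>
  Lower bound. For any lattice of size \<open>M\<close> the pigeonhole principle yields a nonzero dual lattice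
  vector supported on two coordinates, with entries of modulus at most \<open>sqrt M\<close>. The difference of two
  exponentials with univariate frequencies given by these entries vanishes on the whole lattice,
  so the sampling operator maps it to 0, and the ratio of its two norms is at least a constant
  times \<open>M powr (- (\<alpha> + \<beta> - \<gamma>) / 2)\<close>.

  Upper bound. A continuous function in the space has an absolutely convergent Fourier series, so its
  lattice coefficient at \<open>k\<close> is the sum of its Fourier coefficients over the coset of \<open>k\<close> modulo the
  dual lattice. By the reconstruction property every frequency is aliased to at most one \<open>k\<close> in the
  hyperbolic cross. Cauchy-Schwarz on each coset reduces the aliasing error to the supremum over
  \<open>k\<close> of the sums of the inverse weights over the coset outside the cross. The reconstruction property
  also makes the cosets sparse: a dyadic box contained in the cross meets a translate of the dual
  lattice at most once, so a dyadic block of level \<open>n\<close> contains \<open>O(2 ^ n / 2 powr R)\<close> points of a coset,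
  and the sums are dominated by the blocks at the boundary of the cross.

  Component-by-component lattices. Splitting the coordinates according to which of two frequencies
  has the larger level shows that the difference set of the cross has \<open>O(2 powr (2 * R) * R ^ (d - 2))\<close>
  elements. This bounds \<open>M\<close> from above, while the axes in the cross give \<open>ln M \<ge> R * ln 2\<close>.
\<close>

section \<open>Fourier coefficients of continuous functions\<close>

abbreviation fexp :: "int ^ 'n \<Rightarrow> real ^ 'n \<Rightarrow> complex" where
  "fexp k x \<equiv> cis (2 * pi * fdot k x)"

section \<open>Exponentials and their orthogonality\<close>

lemma fdot_minus_left: "fdot (- k) x = - fdot k x"
  by (simp add: fdot_def sum_negf)

lemma fdot_diff_left: "fdot (k - l) x = fdot k x - fdot l x"
  by (simp add: fdot_def left_diff_distrib sum_subtractf)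

lemma fdot_zero_left [simp]: "fdot 0 x = 0"
  by (simp add: fdot_def)

lemma fdot_add_right: "fdot k (x + y) = fdot k x + fdot k y"
  by (simp add: fdot_def distrib_left sum.distrib)

lemma fexp_prod: "fexp k x = (\<Prod>i\<in>UNIV. cis (2 * pi * (of_int (k $ i) * x $ i)))"
  by (simp add: fdot_def cis_conv_exp exp_sum sum_distrib_left)

lemma cis_int_multiple: "cis (2 * pi * of_int n) = 1"
  by (simp add: cis.ctr complex_eq_iff)

lemma fdot_of_int: "fdot k (\<chi> i. of_int (m $ i)) = of_int (\<Sum>i\<in>UNIV. k $ i * m $ i)"
  by (simp add: fdot_def)

lemma periodic1_fexp: "periodic1 (fexp k)"
  unfolding periodic1_def
  by (simp add: fdot_add_right fdot_of_int distrib_left cis_int_multiple flip: cis_mult del: of_int_sum of_int_mult)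

lemma continuous_on_fdot [continuous_intros]: "continuous_on S (fdot k)"
  unfolding fdot_def by (intro continuous_intros)

lemma continuous_on_fexp [continuous_intros]: "continuous_on S (fexp k)"
  by (intro continuous_intros)

text \<open>Fubini for products of functions of one coordinate: \<open>lborel\<close> is the image
  of the product measure indexed by \<open>Basis\<close>, and \<open>axis i 1\<close> identifies the
  coordinates with the basis vectors.\<close>

lemma lborel_integral_prod_cart:
  fixes f :: "'n::finite \<Rightarrow> real \<Rightarrow> complex"
  assumes int: "\<And>i. integrable lborel (f i)"
  shows "(\<integral>x. (\<Prod>i\<in>UNIV. f i (x $ i)) \<partial>(lborel :: (real ^ 'n) measure)) = (\<Prod>i\<in>UNIV. \<integral>x. f i x \<partial>lborel)"
proof -
  interpret P: product_sigma_finite "\<lambda>b :: real ^ 'n. lborel :: real measure" by standard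
  define e :: "'n \<Rightarrow> real ^ 'n" where "e = (\<lambda>i. axis i 1)"
  have inj: "inj e" by (auto simp: inj_def e_def axis_eq_axis)
  have B: "Basis = range e" by (auto simp: Basis_vec_def e_def)
  define F where "F = (\<lambda>b. f (inv e b))"
  have F: "F (e i) = f i" for i using inj by (simp add: F_def)
  have [measurable]: "f i \<in> borel_measurable borel" for i
    using borel_measurable_integrable[OF int[of i]] by simp
  have comp: "(\<Sum>b\<in>Basis. g b *\<^sub>R b) $ i = g (e i)" for g :: "_ \<Rightarrow> real" and i
  proof -
    have "(\<Sum>b\<in>Basis. g b *\<^sub>R b) $ i = (\<Sum>j\<in>UNIV. g (e j) * e j $ i)"
      unfolding B by (simp add: sum.reindex[OF inj])
    also have "\<dots> = (\<Sum>j\<in>UNIV. if j = i then g (e i) else 0)"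
      by (rule sum.cong) (auto simp: e_def axis_def)
    finally show ?thesis by simp
  qed
  have [measurable]: "(\<lambda>x :: real ^ 'n. x $ i) \<in> borel_measurable borel" for i
    by (intro borel_measurable_continuous_onI continuous_intros)
  have "(\<integral>x. (\<Prod>i\<in>UNIV. f i (x $ i)) \<partial>(lborel :: (real ^ 'n) measure))
      = (\<integral>g. (\<Prod>i\<in>UNIV. f i (g (e i))) \<partial>(\<Pi>\<^sub>M b\<in>Basis. lborel))"
    by (subst lborel_eq, subst integral_distr) (measurable, simp only: comp)
  also have "\<dots> = (\<integral>g. (\<Prod>b\<in>Basis. F b (g b)) \<partial>(\<Pi>\<^sub>M b\<in>Basis. lborel))"
    unfolding B by (simp add: prod.reindex[OF inj] F)
  also have "\<dots> = (\<Prod>b\<in>Basis. integral\<^sup>L lborel (F b))"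
    by (rule P.product_integral_prod) (auto simp: F_def int)
  also have "\<dots> = (\<Prod>i\<in>UNIV. \<integral>x. f i x \<partial>lborel)"
    unfolding B by (simp add: prod.reindex[OF inj] F)
  finally show ?thesis .
qed

lemma integral_cis_period:
  "(\<integral>x. indicator {0..<1} x *\<^sub>R cis (2 * pi * (of_int k * x)) \<partial>lborel) = (if k = 0 then 1 else 0)"
proof -
  \<comment> \<open>The half-open period is closed up at the cost of one point, since the
    fundamental theorem of calculus is applied on a compact interval.\<close>
  have ae: "AE x in lborel. indicator {0..<1} x *\<^sub>R cis (2 * pi * (of_int k * x))
     = indicator {0..1} x *\<^sub>R cis (2 * pi * (of_int k * x))"
    using AE_lborel_singleton[of "1::real"] by eventually_elim (auto simp: indicator_def)
  have "(\<integral>x. indicator {0..<1} x *\<^sub>R cis (2 * pi * (of_int k * x)) \<partial>lborel)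
      = (\<integral>x. indicator {0..1} x *\<^sub>R cis (2 * pi * (of_int k * x)) \<partial>lborel)"
  proof (rule integral_cong_AE)
    have [measurable]: "(\<lambda>x :: real. cis (2 * pi * (of_int k * x))) \<in> borel_measurable borel"
      by (intro borel_measurable_continuous_onI continuous_intros)
    show "(\<lambda>x. indicator {0..<1} x *\<^sub>R cis (2 * pi * (of_int k * x))) \<in> borel_measurable lborel"
      "(\<lambda>x. indicator {0..1} x *\<^sub>R cis (2 * pi * (of_int k * x))) \<in> borel_measurable lborel"
      by measurable
  qed (rule ae)
  also have "\<dots> = (if k = 0 then 1 else 0)"
  proof (cases "k = 0")
    case False
    define c where "c = 2 * pi * of_int k"
    have c: "c \<noteq> 0" using False by (simp add: c_def)
    have "(\<integral>x. indicator {0..1} x *\<^sub>R cis (c * x) \<partial>lborel) = - \<i> / of_real c * cis (c * 1) - - \<i> / of_real c * cis (c * 0)"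
    proof (rule integral_FTC_Icc)
      show "continuous_on {0..1} (\<lambda>x. cis (c * x))" by (intro continuous_intros)
      fix x :: real
      have "((\<lambda>x. - \<i> / of_real c * cis (c * x)) has_vector_derivative
               (- \<i> / of_real c * (of_real c * \<i> * cis (c * x)))) (at x within {0..1})"
        unfolding cis_conv_exp
        by (auto intro!: derivative_eq_intros has_vector_derivative_real_field simp: field_simps)
      then show "((\<lambda>x. - \<i> / of_real c * cis (c * x)) has_vector_derivative cis (c * x)) (at x within {0..1})"
        using c by simp
    qed auto
    \<comment> \<open>As \<open>c\<close> is an integer multiple of \<open>2 * pi\<close>, the
      antiderivative takes the same value at both endpoints.\<close>
    also have "cis (c * 1) = 1" using cis_int_multiple[of k] by (simp add: c_def)
    finally show ?thesis using False by (simp add: c_def mult.assoc)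
  qed simp
  finally show ?thesis .
qed

section \<open>Integration of continuous functions over the unit cube\<close>

lemma borel_measurable_unit_cube [measurable]: "(unit_cube :: (real ^ 'n) set) \<in> sets borel"
proof -
  have eq: "unit_cube = (\<Inter>i. {x :: real ^ 'n. 0 \<le> x $ i} \<inter> {x. x $ i < 1})"
    by (auto simp: unit_cube_def)
  have "closed {x :: real ^ 'n. 0 \<le> x $ i}" "open {x :: real ^ 'n. x $ i < 1}" for i
    by (intro closed_Collect_le open_Collect_less continuous_intros)+
  then show ?thesis
    unfolding eq by (intro sets.finite_INT sets.Int borel_closed borel_open) auto
qed

lemma unit_cube_subset_cbox: "unit_cube \<subseteq> cbox (0 :: real ^ 'n) 1"
  by (simp add: unit_cube_def mem_box_cart subset_eq less_imp_le)

lemma box_subset_unit_cube: "box (0 :: real ^ 'n) 1 \<subseteq> unit_cube"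
  by (simp add: unit_cube_def mem_box_cart subset_eq less_imp_le)

lemma set_integrable_unit_cube:
  fixes f :: "real ^ 'n \<Rightarrow> 'b::{banach, second_countable_topology}"
  assumes "continuous_on UNIV f"
  shows "set_integrable lborel unit_cube f"
proof (rule set_integrable_subset)
  show "set_integrable lborel (cbox 0 1) f"
    unfolding set_integrable_def
    by (rule borel_integrable_compact) (auto intro: continuous_on_subset[OF assms])
qed (auto simp: unit_cube_subset_cbox)

text \<open>The half-open cube lies between the open and the closed one, whose difference is
  negligible. This gives access to the results on integrals over compact boxes, such as passing to
  uniform limits.\<close>

lemma set_integral_unit_cube_eq:
  fixes f :: "real ^ 'n \<Rightarrow> 'b::euclidean_space"
  assumes "continuous_on UNIV f"
  shows "(LINT x:unit_cube|lborel. f x) = integral (cbox 0 1) f"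
proof -
  have "(LINT x:unit_cube|lborel. f x) = integral unit_cube f"
    by (rule set_borel_integral_eq_integral(2)[OF set_integrable_unit_cube[OF assms]])
  also have "\<dots> = integral (cbox 0 1) f"
  proof (rule integral_spike_set)
    have "negligible (cbox (0 :: real ^ 'n) 1 - box 0 1)" by (rule negligible_frontier_interval)
    then show "negligible {x \<in> unit_cube - cbox (0 :: real ^ 'n) 1. f x \<noteq> 0}"
      "negligible {x \<in> cbox (0 :: real ^ 'n) 1 - unit_cube. f x \<noteq> 0}"
      by (rule negligible_subset; use unit_cube_subset_cbox box_subset_unit_cube in blast)+
  qed
  finally show ?thesis .
qed

lemma fourier_coeff_eq:
  fixes f :: "real ^ 'n \<Rightarrow> complex"
  assumes "continuous_on UNIV f"
  shows "fourier_coeff f k = integral (cbox 0 1) (\<lambda>x. f x * fexp (- k) x)"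
  unfolding fourier_coeff_def
  by (subst set_integral_unit_cube_eq[symmetric])
     (auto intro!: continuous_intros assms simp: fdot_minus_left)

text \<open>Orthogonality: the integral factorises over the coordinates, and every coordinate in
  which the frequencies differ contributes a zero factor.\<close>

lemma fourier_coeff_fexp: "fourier_coeff (fexp l) k = (if k = l then 1 else 0)"
proof -
  have "fourier_coeff (fexp l) k = (LINT x:unit_cube|lborel. fexp (l - k) x)"
    by (simp add: fourier_coeff_def fdot_diff_left right_diff_distrib flip: cis_mult)
       (simp add: cis_mult)
  also have "\<dots> = (\<integral>x. (\<Prod>i\<in>UNIV. indicator {0..<1} (x $ i) *\<^sub>R cis (2 * pi * (of_int ((l - k) $ i) * x $ i))) \<partial>lborel)"
    unfolding set_lebesgue_integral_def fexp_prod
    by (rule Bochner_Integration.integral_cong) (auto simp: indicator_def unit_cube_def scaleR_conv_of_real prod.distrib)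
  also have "\<dots> = (\<Prod>i\<in>UNIV. \<integral>x. indicator {0..<1} x *\<^sub>R cis (2 * pi * (of_int ((l - k) $ i) * x)) \<partial>lborel)"
  proof (rule lborel_integral_prod_cart)
    fix i
    have "set_integrable lborel {0..1} (\<lambda>x. cis (2 * pi * (of_int ((l - k) $ i) * x)))"
      unfolding set_integrable_def by (intro borel_integrable_compact continuous_intros) auto
    then have "set_integrable lborel {0..<1} (\<lambda>x. cis (2 * pi * (of_int ((l - k) $ i) * x)))"
      by (rule set_integrable_subset) auto
    then show "integrable lborel (\<lambda>x. indicator {0..<1} x *\<^sub>R cis (2 * pi * (of_int ((l - k) $ i) * x)))"
      by (simp add: set_integrable_def)
  qed
  also have "\<dots> = (if k = l then 1 else 0)"
    unfolding integral_cis_period by (simp add: vec_eq_iff eq_commute[of "k $ _"])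
  finally show ?thesis .
qed

section \<open>Linearity, modulation and trigonometric polynomials\<close>

lemma fourier_coeff_add:
  assumes "continuous_on UNIV f" "continuous_on UNIV g"
  shows "fourier_coeff (\<lambda>x. f x + g x) k = fourier_coeff f k + fourier_coeff g k"
  unfolding fourier_coeff_def
  by (subst set_integral_add(2)[symmetric])
     (auto intro!: set_integrable_unit_cube continuous_intros assms simp: distrib_right)

lemma fourier_coeff_cmult: "fourier_coeff (\<lambda>x. c * f x) k = c * fourier_coeff f k"
  unfolding fourier_coeff_def by (simp add: mult.assoc)

lemma fourier_coeff_diff:
  assumes "continuous_on UNIV f" "continuous_on UNIV g"
  shows "fourier_coeff (\<lambda>x. f x - g x) k = fourier_coeff f k - fourier_coeff g k"
  using fourier_coeff_add[OF assms(1), of "\<lambda>x. - 1 * g x" k] fourier_coeff_cmult[of "-1" g k] assms(2)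
  by (auto intro!: continuous_intros)

lemma fourier_coeff_mult_fexp: "fourier_coeff (\<lambda>x. f x * fexp l x) k = fourier_coeff f (k - l)"
  by (simp add: fourier_coeff_def fdot_diff_left right_diff_distrib mult.assoc cis_mult algebra_simps)

lemma continuous_on_trig_poly [continuous_intros]: "continuous_on S (trig_poly I c)"
  unfolding trig_poly_def by (intro continuous_intros)

lemma fourier_coeff_trig_poly:
  assumes "finite I"
  shows "fourier_coeff (trig_poly I c) k = (if k \<in> I then c k else 0)"
  using assms
proof (induction I rule: finite_induct)
  case empty
  then show ?case by (simp add: trig_poly_def fourier_coeff_def)
next
  case (insert l I)
  have "trig_poly (insert l I) c = (\<lambda>x. c l * fexp l x + trig_poly I c x)"
    using insert by (simp add: trig_poly_def fun_eq_iff)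
  then have "fourier_coeff (trig_poly (insert l I) c) k = c l * fourier_coeff (fexp l) k + fourier_coeff (trig_poly I c) k"
    by (simp add: fourier_coeff_add fourier_coeff_cmult continuous_intros)
  then show ?case using insert by (auto simp: fourier_coeff_fexp)
qed

lemma periodic1_trig_poly: "periodic1 (trig_poly I c)"
proof -
  have "fexp k (x + (\<chi> i. of_int (m $ i))) = fexp k x" for k x and m :: "int ^ 'a"
    using periodic1_fexp[of k] unfolding periodic1_def by blast
  then show ?thesis unfolding periodic1_def trig_poly_def by simp
qed

section \<open>Uniqueness of Fourier coefficients\<close>

text \<open>The kernel of the Fourier transform on continuous periodic functions. It is stable under
  multiplication by exponentials, because modulation only shifts coefficients.\<close>

definition zero_fourier :: "(real ^ 'n \<Rightarrow> complex) set" where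
  "zero_fourier = {g. continuous_on UNIV g \<and> periodic1 g \<and> (\<forall>k. fourier_coeff g k = 0)}"

definition torus_embed :: "real ^ 'n \<Rightarrow> complex ^ 'n" where
  "torus_embed x = (\<chi> i. cis (2 * pi * x $ i))"

definition torus_image :: "(complex ^ 'n) set" where
  "torus_image = torus_embed ` cbox 0 1"

lemma zero_fourier_add:
  "f \<in> zero_fourier \<Longrightarrow> g \<in> zero_fourier \<Longrightarrow> (\<lambda>x. f x + g x) \<in> zero_fourier"
  by (auto simp: zero_fourier_def fourier_coeff_add periodic1_def intro: continuous_intros)

lemma zero_fourier_cmult:
  "f \<in> zero_fourier \<Longrightarrow> (\<lambda>x. c * f x) \<in> zero_fourier"
  by (auto simp: zero_fourier_def fourier_coeff_cmult periodic1_def intro: continuous_intros)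

lemma zero_fourier_mult_fexp:
  assumes "f \<in> zero_fourier"
  shows "(\<lambda>x. f x * fexp k x) \<in> zero_fourier"
proof -
  have "periodic1 (\<lambda>x. f x * fexp k x)"
    using assms periodic1_fexp[of k] unfolding zero_fourier_def periodic1_def by simp
  then show ?thesis
    using assms by (auto simp: zero_fourier_def fourier_coeff_mult_fexp intro: continuous_intros)
qed

lemma fdot_axis: "fdot (axis i c) x = of_int c * x $ i"
proof -
  have "fdot (axis i c) x = (\<Sum>j\<in>UNIV. if j = i then of_int c * x $ i else 0)"
    unfolding fdot_def by (rule sum.cong) (auto simp: axis_def)
  then show ?thesis by simp
qed

lemma continuous_on_torus_embed: "continuous_on S torus_embed"
  unfolding torus_embed_def by (intro continuous_intros)

lemma compact_torus_image: "compact torus_image"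
  unfolding torus_image_def by (intro compact_continuous_image continuous_on_torus_embed compact_cbox)

text \<open>The fibres of the embedding are orbits of integer translations: in each coordinate the
  quotient of the two values of \<open>cis\<close> is 1, so the angles differ by a multiple of
  \<open>2 * pi\<close>.\<close>

lemma torus_embed_eq_imp:
  assumes "torus_embed x = torus_embed y"
  shows "\<exists>m :: int ^ 'n. x = y + (\<chi> i. of_int (m $ i))"
proof -
  have "\<exists>n::int. x $ i = y $ i + of_int n" for i
  proof -
    have "cis (2 * pi * x $ i) = cis (2 * pi * y $ i)"
      using assms by (simp add: torus_embed_def vec_eq_iff)
    then have "cis (2 * pi * x $ i - 2 * pi * y $ i) = 1"
      by (simp flip: cis_divide)
    then have "cos (2 * pi * x $ i - 2 * pi * y $ i) = 1"
      by (metis cis.sel(1) one_complex.sel(1))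
    then obtain n :: int where "2 * pi * x $ i - 2 * pi * y $ i = of_int n * 2 * pi"
      unfolding cos_one_2pi_int by blast
    then have "2 * pi * (x $ i) = 2 * pi * (y $ i + of_int n)" by (simp add: algebra_simps)
    then show ?thesis by (intro exI[of _ n]) simp
  qed
  then obtain m where "\<And>i. x $ i = y $ i + of_int (m i :: int)" by metis
  then show ?thesis by (intro exI[of _ "\<chi> i. m i"]) (simp add: vec_eq_iff)
qed

text \<open>A continuous surjection from a compact space onto a Hausdorff space is a quotient map,
  so continuity of \<open>G\<close> can be tested after composition with the embedding.\<close>

lemma continuous_on_torus_lift:
  fixes h :: "real ^ 'n \<Rightarrow> real"
  assumes "continuous_on UNIV h" "\<And>x. G (torus_embed x) = h x"
  shows "continuous_on torus_image G"
proof -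
  have q: "quotient_map (top_of_set (cbox 0 1)) (top_of_set torus_image) (torus_embed :: real ^ 'n \<Rightarrow> _)"
    by (rule T1_Spaces.continuous_imp_quotient_map)
       (auto simp: torus_image_def continuous_on_torus_embed compact_space_subtopology compactin_euclidean_iff Hausdorff_space_subtopology)
  have "continuous_map (top_of_set (cbox 0 1)) euclidean (G \<circ> torus_embed)"
    using assms by (auto simp: o_def intro: continuous_on_subset)
  then show ?thesis
    using continuous_compose_quotient_map[OF q, of euclidean G] by auto
qed

text \<open>
  Stone-Weierstrass cannot be applied on the cube, where periodic functions do not separate points, so
  the functions are moved to the product of unit circles. The approximating algebra consists of the
  functions whose multiplication operators preserve \<open>zero_fourier\<close>, which avoids an explicit
  description of the trigonometric polynomials.
\<close>

lemma zero_fourier_approx: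
  assumes G: "continuous_on torus_image G" and e: "0 < e"
  obtains q :: "real ^ 'n \<Rightarrow> real" where "continuous_on UNIV q"
    "\<And>g. g \<in> zero_fourier \<Longrightarrow> (\<lambda>x. g x * of_real (q x)) \<in> zero_fourier"
    "\<And>x. x \<in> cbox 0 1 \<Longrightarrow> \<bar>G (torus_embed x) - q x\<bar> < e"
proof -
  define P where "P = (\<lambda>p :: complex ^ 'n \<Rightarrow> real. continuous_on UNIV p \<and>
    (\<forall>g\<in>zero_fourier. (\<lambda>x. g x * of_real (p (torus_embed x))) \<in> zero_fourier))"
  \<comment> \<open>Euler's formulas write cosine and sine as combinations of the exponentials with
    frequencies \<open>axis i 1\<close> and \<open>axis i (-1)\<close>, each of which preserves
    \<open>zero_fourier\<close>.\<close>
  have cosP: "P (\<lambda>w. Re (w $ i))" and sinP: "P (\<lambda>w. Im (w $ i))" for i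
  proof -
    have "(\<lambda>x. g x * of_real (cos (2 * pi * x $ i))) \<in> zero_fourier"
         "(\<lambda>x. g x * of_real (sin (2 * pi * x $ i))) \<in> zero_fourier"
      if "g \<in> zero_fourier" for g :: "real ^ 'n \<Rightarrow> complex"
    proof -
      let ?a = "\<lambda>x. g x * fexp (axis i 1) x" and ?b = "\<lambda>x. g x * fexp (axis i (-1)) x"
      have ab: "?a \<in> zero_fourier" "?b \<in> zero_fourier"
        by (intro zero_fourier_mult_fexp that)+
      have "(\<lambda>x. (1/2) * ?a x + (1/2) * ?b x) \<in> zero_fourier"
           "(\<lambda>x. (- \<i>/2) * ?a x + (\<i>/2) * ?b x) \<in> zero_fourier"
        by (intro zero_fourier_add zero_fourier_cmult ab)+
      moreover have "(\<lambda>x. (1/2) * ?a x + (1/2) * ?b x) = (\<lambda>x. g x * of_real (cos (2 * pi * x $ i)))"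
        "(\<lambda>x. (- \<i>/2) * ?a x + (\<i>/2) * ?b x) = (\<lambda>x. g x * of_real (sin (2 * pi * x $ i)))"
        by (auto simp: fun_eq_iff fdot_axis complex_eq_iff field_simps)
      ultimately show "(\<lambda>x. g x * of_real (cos (2 * pi * x $ i))) \<in> zero_fourier"
         "(\<lambda>x. g x * of_real (sin (2 * pi * x $ i))) \<in> zero_fourier" by simp_all
    qed
    then show "P (\<lambda>w. Re (w $ i))" "P (\<lambda>w. Im (w $ i))"
      by (auto simp: P_def torus_embed_def intro!: continuous_intros)
  qed
  have "\<exists>p. P p \<and> (\<forall>w\<in>torus_image. \<bar>G w - p w\<bar> < e)"
  proof (rule Stone_Weierstrass_HOL[OF compact_torus_image, where P = P])
    show "P (\<lambda>w. c)" for c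
      using zero_fourier_cmult[of _ "of_real c"] by (auto simp: P_def mult.commute)
    show "continuous_on torus_image f" if "P f" for f
      using that continuous_on_subset by (auto simp: P_def)
    show "P (\<lambda>x. f x + g x)" if "P f \<and> P g" for f g
      using that by (auto simp: P_def distrib_left intro!: continuous_intros zero_fourier_add)
    show "P (\<lambda>x. f x * g x)" if fg: "P f \<and> P g" for f g
    proof -
      have "(\<lambda>x. h x * of_real (f (torus_embed x)) * of_real (g (torus_embed x))) \<in> zero_fourier"
        if "h \<in> zero_fourier" for h
      proof -
        have "(\<lambda>x. h x * of_real (f (torus_embed x))) \<in> zero_fourier"
          using fg that by (auto simp: P_def)
        then show ?thesis
          using fg unfolding P_def by (elim conjE) (drule (1) bspec, drule (1) bspec, assumption)
      qed
      then show ?thesis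
        using fg by (auto simp: P_def mult.assoc intro!: continuous_intros)
    qed
    show "\<exists>f. P f \<and> f x \<noteq> f y" if "x \<in> torus_image \<and> y \<in> torus_image \<and> x \<noteq> y" for x y
      using that cosP sinP by (metis complex_eq_iff vec_eq_iff)
  qed (use G e in auto)
  then obtain p where p: "P p" "\<And>w. w \<in> torus_image \<Longrightarrow> \<bar>G w - p w\<bar> < e" by blast
  show thesis
  proof (rule that[of "p \<circ> torus_embed"])
    show "continuous_on UNIV (p \<circ> (torus_embed :: real ^ 'n \<Rightarrow> _))"
      using p(1) by (intro continuous_on_compose continuous_on_torus_embed)
        (auto simp: P_def intro: continuous_on_subset)
  qed (use p in \<open>auto simp: P_def torus_image_def\<close>)
qed

text \<open>If a multiplier \<open>q\<close> is uniformly within \<open>e\<close> of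
  \<open>Re g\<close>, then \<open>Re g * q\<close> has integral 0, so the integral of the square of
  \<open>Re g\<close> equals that of \<open>Re g * (Re g - q)\<close>. This is at most
  \<open>e\<close> times a constant, hence the square integrates to 0.\<close>

lemma zero_fourier_Re_eq_0:
  fixes g :: "real ^ 'n \<Rightarrow> complex"
  assumes g: "g \<in> zero_fourier"
  shows "Re (g x) = 0"
proof -
  have cont: "continuous_on UNIV g" and per: "periodic1 g"
    using g by (auto simp: zero_fourier_def)
  note cont' = continuous_on_subset[OF cont subset_UNIV]
  \<comment> \<open>\<open>SOME\<close> picks an arbitrary preimage; periodicity makes the value
    independent of the choice.\<close>
  define G where "G w = Re (g (SOME x. torus_embed x = w))" for w
  have G: "G (torus_embed x) = Re (g x)" for x
  proof -
    have "torus_embed (SOME y. torus_embed y = torus_embed x) = torus_embed x"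
      by (rule someI) (rule refl)
    then show ?thesis
      using torus_embed_eq_imp per unfolding G_def periodic1_def by metis
  qed
  have contG: "continuous_on torus_image G"
    by (rule continuous_on_torus_lift[of "\<lambda>x. Re (g x)"]) (auto intro!: continuous_intros cont G)
  let ?C = "cbox (0 :: real ^ 'n) 1"
  define A where "A = integral ?C (\<lambda>x. \<bar>Re (g x)\<bar>)"
  have A: "A \<ge> 0" unfolding A_def
    by (rule integral_nonneg) (auto intro!: integrable_continuous continuous_intros cont')
  have le: "integral ?C (\<lambda>x. (Re (g x))\<^sup>2) \<le> e * A" if e: "e > 0" for e
  proof -
    obtain q :: "real ^ 'n \<Rightarrow> real" where q: "continuous_on UNIV q"
      "\<And>g. g \<in> zero_fourier \<Longrightarrow> (\<lambda>x. g x * of_real (q x)) \<in> zero_fourier"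
      "\<And>x. x \<in> ?C \<Longrightarrow> \<bar>G (torus_embed x) - q x\<bar> < e"
      using zero_fourier_approx[OF contG e] by metis
    note q' = continuous_on_subset[OF q(1) subset_UNIV]
    have int: "(\<lambda>x. g x * of_real (q x)) integrable_on ?C"
      by (intro integrable_continuous continuous_intros cont' q')
    \<comment> \<open>The coefficient at frequency 0 is the plain integral over the cube.\<close>
    have "fourier_coeff (\<lambda>x. g x * of_real (q x)) 0 = 0"
      using q(2)[OF g] by (simp add: zero_fourier_def)
    then have "integral ?C (\<lambda>x. g x * of_real (q x)) = 0"
      by (subst (asm) fourier_coeff_eq) (auto intro!: continuous_intros cont q(1))
    then have 0: "integral ?C (\<lambda>x. Re (g x) * q x) = 0"
      using integral_linear[OF int bounded_linear_Re] by (simp add: o_def)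
    have "integral ?C (\<lambda>x. (Re (g x))\<^sup>2)
        = integral ?C (\<lambda>x. Re (g x) * (Re (g x) - q x) + Re (g x) * q x)"
      by (simp add: algebra_simps power2_eq_square)
    also have "\<dots> = integral ?C (\<lambda>x. Re (g x) * (Re (g x) - q x))"
      by (subst Henstock_Kurzweil_Integration.integral_add)
         (auto intro!: integrable_continuous continuous_intros cont' q' simp: 0)
    also have "\<dots> \<le> integral ?C (\<lambda>x. e * \<bar>Re (g x)\<bar>)"
    proof (rule integral_le)
      fix x assume x: "x \<in> ?C"
      have "Re (g x) * (Re (g x) - q x) \<le> \<bar>Re (g x)\<bar> * \<bar>Re (g x) - q x\<bar>"
        by (metis abs_ge_self abs_mult)
      also have "\<dots> \<le> \<bar>Re (g x)\<bar> * e"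
        using q(3)[OF x] by (intro mult_left_mono) (auto simp: G)
      finally show "Re (g x) * (Re (g x) - q x) \<le> e * \<bar>Re (g x)\<bar>" by (simp add: mult.commute)
    qed (auto intro!: integrable_continuous continuous_intros cont' q')
    also have "\<dots> = e * A" by (simp add: A_def)
    finally show ?thesis .
  qed
  have "integral ?C (\<lambda>x. (Re (g x))\<^sup>2) \<le> 0 + e" if "e > 0" for e
  proof -
    \<comment> \<open>Dividing by \<open>A + 1\<close> instead of \<open>A\<close> also covers the
      case \<open>A = 0\<close>.\<close>
    have "integral ?C (\<lambda>x. (Re (g x))\<^sup>2) \<le> e / (A + 1) * A"
      using that A by (intro le) auto
    also have "\<dots> \<le> e" using that A by (simp add: field_simps)
    finally show ?thesis by simp
  qed
  then have "integral ?C (\<lambda>x. (Re (g x))\<^sup>2) \<le> 0" by (rule field_le_epsilon)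
  moreover have "integral ?C (\<lambda>x. (Re (g x))\<^sup>2) \<ge> 0"
    by (rule integral_nonneg) (auto intro!: integrable_continuous continuous_intros cont')
  ultimately have "integral ?C (\<lambda>x. (Re (g x))\<^sup>2) = 0" by simp
  \<comment> \<open>The cube has nonempty interior, so a nonnegative continuous function with
    integral 0 vanishes on all of it.\<close>
  moreover have "(1/2) *\<^sub>R 1 \<in> box (0 :: real ^ 'n) 1" by (simp add: mem_box_cart)
  ultimately have *: "Re (g y) = 0" if "y \<in> ?C" for y
    using that by (subst (asm) integral_cbox_eq_0_iff) (auto intro!: continuous_intros cont')
  define m :: "int ^ 'n" where "m = (\<chi> i. - \<lfloor>x $ i\<rfloor>)"
  have "x + (\<chi> i. of_int (m $ i)) \<in> ?C"
    unfolding m_def mem_box_cart by (auto simp: less_imp_le) linarith+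
  then have "Re (g (x + (\<chi> i. of_int (m $ i)))) = 0" by (rule *)
  then show ?thesis using per unfolding periodic1_def by metis
qed

text \<open>Multiplication by \<open>- \<i>\<close> turns the imaginary part into a real part, so
  the previous result applies twice.\<close>

theorem fourier_uniqueness:
  fixes g :: "real ^ 'n \<Rightarrow> complex"
  assumes "continuous_on UNIV g" "periodic1 g" "\<And>k. fourier_coeff g k = 0"
  shows "g x = 0"
proof -
  have g: "g \<in> zero_fourier" using assms by (simp add: zero_fourier_def)
  have "Re (- \<i> * g x) = 0" by (rule zero_fourier_Re_eq_0[OF zero_fourier_cmult[OF g]])
  with zero_fourier_Re_eq_0[OF g, of x] show ?thesis by (simp add: complex_eq_iff)
qed

text \<open>By the Weierstrass test the series converges uniformly to a continuous periodic
  \<open>S\<close>. Its coefficients are those of \<open>f\<close>, so uniqueness gives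
  \<open>S = f\<close>.\<close>

theorem fourier_series_has_sum:
  fixes f :: "real ^ 'n \<Rightarrow> complex"
  assumes cont: "continuous_on UNIV f" and per: "periodic1 f"
    and sum: "(\<lambda>k. cmod (fourier_coeff f k)) summable_on UNIV"
  shows "((\<lambda>k. fourier_coeff f k * fexp k x) has_sum f x) UNIV"
proof -
  let ?t = "\<lambda>k x. fourier_coeff f k * fexp k x"
  define S where "S = (\<lambda>x. \<Sum>\<^sub>\<infinity>k. ?t k x)"
  have summ: "(\<lambda>k. ?t k x) summable_on UNIV" for x
    by (rule abs_summable_summable) (simp add: norm_mult sum)
  have unif: "uniform_limit UNIV (\<lambda>X x. \<Sum>k\<in>X. ?t k x) S (finite_subsets_at_top UNIV)"
    unfolding S_def by (rule Weierstrass_m_test_general[OF _ sum]) (simp add: norm_mult)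
  have contS: "continuous_on UNIV S"
    by (rule uniform_limit_theorem[OF _ unif]) (auto intro!: always_eventually continuous_intros)
  have perS: "periodic1 S"
  proof -
    have "fexp k (x + (\<chi> i. of_int (m $ i))) = fexp k x" for k x and m :: "int ^ 'n"
      using periodic1_fexp[of k] unfolding periodic1_def by blast
    then show ?thesis unfolding periodic1_def S_def by simp
  qed
  have coeffS: "fourier_coeff S l = fourier_coeff f l" for l
  proof -
    have "uniform_limit (cbox 0 1) (\<lambda>X x. (\<Sum>k\<in>X. ?t k x) * fexp (- l) x) (\<lambda>x. S x * fexp (- l) x) (finite_subsets_at_top UNIV)"
      (is "uniform_limit _ ?P ?Q _")
    proof (rule uniform_limitI)
      fix e :: real assume "e > 0"
      from uniform_limitD[OF unif this]
      show "\<forall>\<^sub>F X in finite_subsets_at_top UNIV. \<forall>x\<in>cbox 0 1. dist (?P X x) (?Q x) < e"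
        by eventually_elim (simp add: dist_norm norm_mult flip: left_diff_distrib)
    qed
    then obtain I J where I: "\<And>X. ((\<lambda>x. ?P X x) has_integral I X) (cbox 0 1)"
      and J: "(?Q has_integral J) (cbox 0 1)"
      and lim: "(I \<longlongrightarrow> J) (finite_subsets_at_top UNIV)"
      by (rule uniform_limit_integral_cbox) (auto intro!: continuous_intros)
    have "fourier_coeff S l = J"
      using fourier_coeff_eq[OF contS] J by (simp add: integral_unique)
    \<comment> \<open>Each \<open>I X\<close> is a coefficient of a trigonometric polynomial, so the
      net is constant as soon as \<open>X\<close> contains \<open>l\<close>.\<close>
    have "I X = fourier_coeff (trig_poly X (fourier_coeff f)) l" for X
      using integral_unique[OF I[of X]] by (simp add: fourier_coeff_eq continuous_intros trig_poly_def)
    then have "\<forall>\<^sub>F X in finite_subsets_at_top UNIV. I X = fourier_coeff f l"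
      unfolding eventually_finite_subsets_at_top
      by (intro exI[of _ "{l}"]) (auto simp: fourier_coeff_trig_poly)
    then have "(I \<longlongrightarrow> fourier_coeff f l) (finite_subsets_at_top UNIV)"
      by (rule tendsto_eventually)
    from tendsto_unique[OF _ lim this] show ?thesis
      using \<open>fourier_coeff S l = J\<close> by simp
  qed
have "f x - S x = 0" for x
    by (rule fourier_uniqueness[of "\<lambda>x. f x - S x"])
       (use cont contS per perS coeffS in \<open>auto intro!: continuous_intros simp: fourier_coeff_diff periodic1_def\<close>)
  then have "f x = S x" by simp
  then show ?thesis using has_sum_infsum[OF summ[of x]] by (simp add: S_def)
qed

section \<open>Dyadic levels and counting\<close>

text \<open>The index of the dyadic block containing \<open>n\<close>. As a least exponent it
  satisfies \<open>dlevel_le_iff\<close>, which turns level bounds into bounds on the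
  modulus.\<close>

definition dlevel :: "int \<Rightarrow> nat" where
  "dlevel n = (LEAST j. \<bar>n\<bar> \<le> 2 ^ j)"

lemma abs_le_2_power_nat: "\<bar>n :: int\<bar> \<le> 2 ^ nat \<bar>n\<bar>"
proof -
  have "int (nat \<bar>n\<bar>) < 2 ^ nat \<bar>n\<bar>"
    using of_nat_less_two_power by blast
  then show ?thesis by simp
qed

lemma dlevel_le_iff: "dlevel n \<le> j \<longleftrightarrow> \<bar>n\<bar> \<le> 2 ^ j"
proof
  assume "dlevel n \<le> j"
  have "\<bar>n\<bar> \<le> 2 ^ dlevel n"
    unfolding dlevel_def by (rule LeastI_ex) (use abs_le_2_power_nat in blast)
  also have "\<dots> \<le> 2 ^ j" using \<open>dlevel n \<le> j\<close> by (intro power_increasing) auto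
  finally show "\<bar>n\<bar> \<le> 2 ^ j" .
qed (auto simp: dlevel_def intro: Least_le)

lemma dyadic_block_iff: "n \<in> dyadic_block j \<longleftrightarrow> dlevel n = j"
proof (cases j)
  case 0
  then have "dlevel n = j \<longleftrightarrow> \<bar>n\<bar> \<le> 1" using dlevel_le_iff[of n 0] by auto
  then show ?thesis using 0 by (auto simp: dyadic_block_def)
next
  case (Suc i)
  have "dlevel n = j \<longleftrightarrow> dlevel n \<le> Suc i \<and> \<not> dlevel n \<le> i" using Suc by auto
  also have "\<dots> \<longleftrightarrow> \<bar>n\<bar> \<le> 2 ^ Suc i \<and> \<not> \<bar>n\<bar> \<le> 2 ^ i" by (simp only: dlevel_le_iff)
  finally show ?thesis using Suc by (auto simp: dyadic_block_def)
qed

definition total_level :: "int ^ 'n \<Rightarrow> nat" where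
  "total_level k = (\<Sum>i\<in>UNIV. dlevel (k $ i))"

text \<open>The blocks partition the integers, so the vector of levels of \<open>k\<close> is the
  only index whose block can contain \<open>k\<close>.\<close>

lemma hyp_cross_iff: "k \<in> hyp_cross R \<longleftrightarrow> real (total_level (k :: int ^ 'n)) \<le> R + real CARD('n) - 1"
proof -
  have "(\<forall>i. k $ i \<in> dyadic_block (j $ i)) \<longleftrightarrow> j = (\<chi> i. dlevel (k $ i))" for j
    by (auto simp: dyadic_block_iff vec_eq_iff)
  then show ?thesis by (auto simp: hyp_cross_def hc_levels_def total_level_def)
qed

text \<open>The integer threshold for total levels that replaces the real bound
  \<open>R + d - 1\<close> when \<open>R \<ge> 1\<close>. The type argument supplies the
  dimension.\<close>

definition cross_level :: "'n itself \<Rightarrow> real \<Rightarrow> nat" where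
  "cross_level _ R = nat \<lfloor>R\<rfloor> + CARD('n) - 1"

lemma hyp_cross_iff_nat:
  assumes "R \<ge> 1"
  shows "k \<in> hyp_cross R \<longleftrightarrow> total_level (k :: int ^ 'n) \<le> cross_level TYPE('n) R"
proof -
  have "CARD('n) \<ge> 1" by (simp add: Suc_leI)
  then show ?thesis
    unfolding hyp_cross_iff cross_level_def using assms by linarith
qed

lemma cross_level_bounds:
  assumes "R \<ge> 1" "CARD('n::finite) \<ge> 2"
  shows "R \<le> real (cross_level TYPE('n) R)" "real (cross_level TYPE('n) R) \<le> R + real CARD('n) - 1"
  unfolding cross_level_def using assms by linarith+

text \<open>In a block of positive level the modulus is at least half the upper end, and squaring
  this loss gives the factor 4. At level 0 the summand 1 suffices.\<close>

lemma one_plus_square_ge: "4 ^ dlevel n \<le> 4 * (1 + (real_of_int n)\<^sup>2)"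
proof (cases "dlevel n")
  case (Suc j)
  then have "\<not> dlevel n \<le> j" by simp
  then have "2 ^ j \<le> \<bar>n\<bar>" unfolding dlevel_le_iff by simp
  then have "(2 ^ j :: real) \<le> \<bar>real_of_int n\<bar>"
    by (metis of_int_abs of_int_le_iff of_int_numeral of_int_power)
  then have "(2 ^ j)\<^sup>2 \<le> (real_of_int n)\<^sup>2" by (metis abs_le_square_iff abs_numeral power_abs)
  moreover have "(2 ^ j)\<^sup>2 = (4 ^ j :: real)" by (simp add: power2_eq_square flip: power_mult_distrib)
  ultimately show ?thesis using Suc by simp
qed simp

lemma square_le: "(real_of_int n)\<^sup>2 \<le> 4 ^ dlevel n"
proof -
  have "\<bar>n\<bar> \<le> 2 ^ dlevel n" using dlevel_le_iff by blast
  then have "\<bar>real_of_int n\<bar> \<le> 2 ^ dlevel n"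
    by (metis of_int_abs of_int_le_iff of_int_numeral of_int_power)
  then have "(real_of_int n)\<^sup>2 \<le> (2 ^ dlevel n)\<^sup>2" by (metis abs_le_square_iff abs_numeral power_abs)
  moreover have "(2 ^ dlevel n)\<^sup>2 = (4 ^ dlevel n :: real)" by (simp add: power2_eq_square flip: power_mult_distrib)
  ultimately show ?thesis by simp
qed

lemma one_plus_square_le: "1 + (real_of_int n)\<^sup>2 \<le> 2 * 4 ^ dlevel n"
proof -
  have "(1::real) \<le> 4 ^ dlevel n" by simp
  with square_le[of n] show ?thesis by linarith
qed

section \<open>Counting in dyadic boxes and level sets\<close>

lemma bij_betw_vec_PiE: "bij_betw vec_nth {k :: 'a ^ 'n. \<forall>i. k $ i \<in> S i} (PiE UNIV S)"
  by (rule bij_betwI[where g = vec_lambda]) (auto simp: PiE_def)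

lemma card_vec: "card {k :: 'a ^ 'n. \<forall>i. k $ i \<in> S i} = (\<Prod>i\<in>UNIV. card (S i))"
  using bij_betw_same_card[OF bij_betw_vec_PiE[of S]] by (simp add: card_PiE)

lemma finite_vec:
  assumes "\<And>i. finite (S i)"
  shows "finite {k :: 'a ^ 'n. \<forall>i. k $ i \<in> S i}"
  using bij_betw_finite[OF bij_betw_vec_PiE[of S]] finite_PiE[of UNIV S] assms by simp

definition dyadic_box :: "('n \<Rightarrow> nat) \<Rightarrow> (int ^ 'n) set" where
  "dyadic_box l = {k. \<forall>i. \<bar>k $ i\<bar> \<le> 2 ^ l i}"

lemma dyadic_box_eq: "dyadic_box l = {k. \<forall>i. k $ i \<in> {- (2 ^ l i)..2 ^ l i}}"
  by (auto simp: dyadic_box_def abs_le_iff) (metis minus_le_iff)+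

lemma finite_dyadic_box: "finite (dyadic_box l)"
  unfolding dyadic_box_eq by (rule finite_vec) simp

lemma card_dyadic_box_le: "real (card (dyadic_box (l :: 'n::finite \<Rightarrow> nat))) \<le> 3 ^ CARD('n) * 2 ^ (\<Sum>i\<in>UNIV. l i)"
proof -
  have "real (card (dyadic_box l)) = (\<Prod>i\<in>UNIV. real (card {- (2 ^ l i)..(2::int) ^ l i}))"
    unfolding dyadic_box_eq by (simp only: card_vec of_nat_prod)
  also have "\<dots> \<le> (\<Prod>i\<in>UNIV. 3 * 2 ^ l i)"
  proof (rule prod_mono, intro conjI)
    fix i
    have "real (card {- (2 ^ l i)..(2::int) ^ l i}) = 2 * 2 ^ l i + 1"
      by (simp add: nat_add_distrib nat_mult_distrib nat_power_eq)
    also have "\<dots> \<le> 3 * 2 ^ l i" by simp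
    finally show "real (card {- (2 ^ l i)..(2::int) ^ l i}) \<le> 3 * 2 ^ l i" .
  qed simp
  also have "\<dots> = 3 ^ CARD('n) * 2 ^ (\<Sum>i\<in>UNIV. l i)"
    by (simp add: prod.distrib power_sum)
  finally show ?thesis .
qed

lemma mem_dyadic_box_iff: "k \<in> dyadic_box l \<longleftrightarrow> (\<forall>i. dlevel (k $ i) \<le> l i)"
  by (simp add: dyadic_box_def dlevel_le_iff)

lemma total_level_le_of_box: "k \<in> dyadic_box l \<Longrightarrow> total_level k \<le> (\<Sum>i\<in>UNIV. l i)"
  unfolding mem_dyadic_box_iff total_level_def by (intro sum_mono) auto

lemma finite_hyp_cross:
  assumes "R \<ge> 1"
  shows "finite (hyp_cross R :: (int ^ 'n) set)"
proof (rule finite_subset)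
  show "hyp_cross R \<subseteq> dyadic_box (\<lambda>i::'n. cross_level TYPE('n) R)"
  proof
    fix k :: "int ^ 'n" assume "k \<in> hyp_cross R"
    then have "total_level k \<le> cross_level TYPE('n) R" by (simp add: hyp_cross_iff_nat assms)
    moreover have "dlevel (k $ i) \<le> total_level k" for i
      unfolding total_level_def by (rule member_le_sum) auto
    ultimately show "k \<in> dyadic_box (\<lambda>i. cross_level TYPE('n) R)"
      unfolding mem_dyadic_box_iff using le_trans by blast
  qed
qed (rule finite_dyadic_box)

text \<open>Components are raised one unit at a time. The result supplies cells of prescribed volume
  that fit inside a given box.\<close>

lemma exists_sublevel:
  fixes j :: "'n::finite \<Rightarrow> nat"
  assumes "N \<le> (\<Sum>i\<in>UNIV. j i)"
  shows "\<exists>l. (\<forall>i. l i \<le> j i) \<and> (\<Sum>i\<in>UNIV. l i) = N"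
  using assms
proof (induction N)
  case 0
  then show ?case by (intro exI[of _ "\<lambda>_. 0"]) simp
next
  case (Suc N)
  then obtain l where l: "\<And>i. l i \<le> j i" "(\<Sum>i\<in>UNIV. l i) = N" by auto
  have "\<exists>i. l i < j i"
  proof (rule ccontr)
    assume "\<nexists>i. l i < j i"
    then have "(\<Sum>i\<in>UNIV. j i) \<le> (\<Sum>i\<in>UNIV. l i)" by (intro sum_mono) (auto simp: not_less)
    then show False using Suc.prems l(2) by simp
  qed
  then obtain i where i: "l i < j i" by blast
  have "(\<Sum>s\<in>UNIV. (l(i := Suc (l i))) s) = Suc N"
    using l(2) by (simp add: sum.remove[of UNIV i])
  then show ?case using l(1) i by (intro exI[of _ "l(i := Suc (l i))"]) auto
qed

text \<open>
  The box \<open>dyadic_box j\<close> is cut into cells of side lengths \<open>2 ^ l i\<close>, where \<open>l \<le> j\<close> has total \<open>N\<close>. Each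
  cell contains at most one point of \<open>X\<close>.
\<close>

lemma card_separated_le:
  fixes X :: "(int ^ 'n) set" and j :: "'n \<Rightarrow> nat"
  assumes sep: "\<And>h h' l. h \<in> X \<Longrightarrow> h' \<in> X \<Longrightarrow> (\<Sum>i\<in>UNIV. l i) = N \<Longrightarrow> h - h' \<in> dyadic_box l \<Longrightarrow> h = h'"
    and N: "N \<le> (\<Sum>i\<in>UNIV. j i)"
  shows "real (card (X \<inter> dyadic_box j)) \<le> 3 ^ CARD('n) * 2 ^ (\<Sum>i\<in>UNIV. j i) / 2 ^ N"
proof -
  obtain l where l: "\<And>i. l i \<le> j i" "(\<Sum>i\<in>UNIV. l i) = N"
    using exists_sublevel[OF N] by blast
  define cell where "cell h = (\<chi> i. h $ i div 2 ^ l i)" for h :: "int ^ 'n"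
  have inj: "inj_on cell (X \<inter> dyadic_box j)"
  proof (rule inj_onI)
    fix h h' assume h: "h \<in> X \<inter> dyadic_box j" "h' \<in> X \<inter> dyadic_box j" and eq: "cell h = cell h'"
    \<comment> \<open>Equal quotients leave only the difference of two remainders, both in the range
      from 0 to below \<open>2 ^ l i\<close>.\<close>
    have "\<bar>h $ i - h' $ i\<bar> \<le> 2 ^ l i" for i
    proof -
      have "h $ i div 2 ^ l i = h' $ i div 2 ^ l i" using eq by (simp add: cell_def vec_eq_iff)
      then have "h $ i - h' $ i = h $ i mod 2 ^ l i - h' $ i mod 2 ^ l i"
        by (metis add_diff_cancel_left mult_div_mod_eq)
      moreover have "0 \<le> h $ i mod 2 ^ l i" "h $ i mod 2 ^ l i < 2 ^ l i"
        "0 \<le> h' $ i mod 2 ^ l i" "h' $ i mod 2 ^ l i < 2 ^ l i" by simp_all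
      ultimately show ?thesis by linarith
    qed
    then show "h = h'" using sep[OF _ _ l(2)] h by (simp add: dyadic_box_def)
  qed
  \<comment> \<open>The cell labels lie in the box with levels \<open>j i - l i\<close>, whose
    cardinality bounds the number of occupied cells.\<close>
  have "cell ` (X \<inter> dyadic_box j) \<subseteq> dyadic_box (\<lambda>i. j i - l i)"
  proof (clarsimp simp: dyadic_box_def cell_def)
    fix h :: "int ^ 'n" and i assume h: "\<forall>i. \<bar>h $ i\<bar> \<le> 2 ^ j i"
    have eq: "2 ^ j i = 2 ^ (j i - l i) * (2 :: int) ^ l i" using l(1)[of i] by (simp flip: power_add)
    have hi: "- (2 ^ j i) \<le> h $ i" "h $ i \<le> 2 ^ j i" using h[rule_format, of i] by auto
    have "h $ i div 2 ^ l i \<le> 2 ^ j i div 2 ^ l i" using hi by (intro zdiv_mono1) auto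
    moreover have "(- (2 ^ (j i - l i)) * 2 ^ l i) div 2 ^ l i \<le> h $ i div 2 ^ l i"
      using hi eq by (intro zdiv_mono1) auto
    moreover have "(- (2 ^ (j i - l i)) * 2 ^ l i) div 2 ^ l i = (- (2 ^ (j i - l i)) :: int)"
      by (rule nonzero_mult_div_cancel_right) simp
    ultimately show "\<bar>h $ i div 2 ^ l i\<bar> \<le> 2 ^ (j i - l i)"
      unfolding eq by simp
  qed
  then have "card (cell ` (X \<inter> dyadic_box j)) \<le> card (dyadic_box (\<lambda>i. j i - l i))"
    by (rule card_mono[OF finite_dyadic_box])
  then have "real (card (X \<inter> dyadic_box j)) \<le> real (card (dyadic_box (\<lambda>i. j i - l i)))"
    by (simp add: card_image[OF inj])
  also have "\<dots> \<le> 3 ^ CARD('n) * 2 ^ (\<Sum>i\<in>UNIV. j i - l i)" by (rule card_dyadic_box_le)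
  also have "(\<Sum>i\<in>UNIV. j i - l i) = (\<Sum>i\<in>UNIV. j i) - N"
    using l by (simp add: sum_subtractf_nat)
  also have "3 ^ CARD('n) * 2 ^ ((\<Sum>i\<in>UNIV. j i) - N) = 3 ^ CARD('n) * 2 ^ (\<Sum>i\<in>UNIV. j i) / (2 ^ N :: real)"
    using N by (simp add: power_diff)
  finally show ?thesis .
qed

text \<open>
  Since the total is fixed, an element of \<open>J\<close> is determined by its values away from \<open>i\<close>.
\<close>

lemma sum_prod_fixed_total_le:
  fixes g :: "nat \<Rightarrow> real"
  assumes "finite B" "i \<in> B" "finite J"
    and J: "\<And>m. m \<in> J \<Longrightarrow> m \<in> extensional B \<and> (\<Sum>s\<in>B. m s) = n"
    and g: "\<And>a. g a \<ge> 0"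
  shows "(\<Sum>m\<in>J. \<Prod>s\<in>B - {i}. g (m s)) \<le> (\<Sum>a\<le>n. g a) ^ (card B - 1)"
proof -
  define \<rho> where "\<rho> m = restrict m (B - {i})" for m :: "'a \<Rightarrow> nat"
  have inj: "inj_on \<rho> J"
  proof (rule inj_onI)
    fix m m' assume m: "m \<in> J" "m' \<in> J" and eq: "\<rho> m = \<rho> m'"
    then have *: "m s = m' s" if "s \<in> B - {i}" for s
      using that by (metis \<rho>_def restrict_apply')
    then have "(\<Sum>s\<in>B - {i}. m s) = (\<Sum>s\<in>B - {i}. m' s)" by simp
    then have "m i = m' i"
      using J[OF m(1)] J[OF m(2)] by (simp add: sum.remove[OF assms(1,2)])
    then show "m = m'"
      using * J[OF m(1)] J[OF m(2)] by (intro extensionalityI[of _ B]) auto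
  qed
  have sub: "\<rho> ` J \<subseteq> PiE (B - {i}) (\<lambda>_. {..n})"
  proof -
    have "m s \<le> n" if "m \<in> J" "s \<in> B" for m s
      using J[OF that(1)] member_le_sum[OF that(2), of m] assms(1) by auto
    then show ?thesis by (auto simp: \<rho>_def PiE_def extensional_def split: if_splits)
  qed
  have "(\<Sum>m\<in>J. \<Prod>s\<in>B - {i}. g (m s)) = (\<Sum>m\<in>J. \<Prod>s\<in>B - {i}. g (\<rho> m s))"
    by (simp add: \<rho>_def)
  also have "\<dots> = (\<Sum>p\<in>\<rho> ` J. \<Prod>s\<in>B - {i}. g (p s))"
    by (simp add: sum.reindex[OF inj])
  also have "\<dots> \<le> (\<Sum>p\<in>PiE (B - {i}) (\<lambda>_. {..n}). \<Prod>s\<in>B - {i}. g (p s))"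
    using assms(1) g by (intro sum_mono2 sub finite_PiE prod_nonneg) auto
  also have "\<dots> = (\<Prod>s\<in>B - {i}. \<Sum>a\<le>n. g a)"
    using assms(1) by (subst prod_sum_PiE) auto
  also have "\<dots> = (\<Sum>a\<le>n. g a) ^ (card B - 1)"
    using assms(1,2) by simp
  finally show ?thesis .
qed

section \<open>Sums of inverse weights\<close>

text \<open>Ratio test: the quotient of consecutive terms tends to \<open>q\<close>, hence is
  eventually below the midpoint \<open>c\<close> between \<open>q\<close> and 1.\<close>

lemma summable_power_mult_poly:
  fixes q :: real
  assumes "0 < q" "q < 1"
  shows "summable (\<lambda>n. q ^ n * (real n + 1) ^ e)"
proof -
  define c where "c = (q + 1) / 2"
  have c: "q < c" "c < 1" using assms by (auto simp: c_def)
  have "(\<lambda>n. q * (1 + inverse (real (Suc n))) ^ e) \<longlonglongrightarrow> q * (1 + 0) ^ e"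
    by (intro tendsto_intros LIMSEQ_inverse_real_of_nat)
  then have "\<forall>\<^sub>F n in sequentially. q * (1 + inverse (real (Suc n))) ^ e < c"
    using c by (intro order_tendstoD) auto
  then obtain N where N: "\<And>n. n \<ge> N \<Longrightarrow> q * (1 + inverse (real (Suc n))) ^ e < c"
    unfolding eventually_sequentially by blast
  show ?thesis
  proof (rule summable_ratio_test[OF c(2)])
    fix n assume "n \<ge> N"
    have "real (Suc n) + 1 = (1 + inverse (real (Suc n))) * (real n + 1)" by (simp add: field_simps)
    then have "q ^ Suc n * (real (Suc n) + 1) ^ e
        = (q * (1 + inverse (real (Suc n))) ^ e) * (q ^ n * (real n + 1) ^ e)"
      by (simp only: power_mult_distrib power_Suc mult_ac)
    also have "\<dots> \<le> c * (q ^ n * (real n + 1) ^ e)"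
      using N[OF \<open>n \<ge> N\<close>] assms by (intro mult_right_mono) auto
    finally show "norm (q ^ Suc n * (real (Suc n) + 1) ^ e) \<le> c * norm (q ^ n * (real n + 1) ^ e)"
      using assms by simp
  qed
qed

text \<open>After the shift \<open>m = r + n\<close> the tail is \<open>q ^ r\<close> times a
  convergent series in \<open>n\<close>. For \<open>y = 1\<close> the inner sum is
  \<open>m + 1\<close>, at most \<open>(r + 1) * (n + 1)\<close>, so a power of \<open>r + 1\<close>
  survives; for \<open>y < 1\<close> it is bounded by a geometric series. The two cases of the
  theorem originate here.\<close>

lemma geometric_tail_le:
  fixes q y :: real
  assumes q: "0 < q" "q < 1" and y: "0 < y" "y \<le> 1"
  obtains C where "C > 0"
    "\<And>r N. (\<Sum>m=r..N. q ^ m * (\<Sum>a\<le>m. y ^ a) ^ e) \<le> C * q ^ r * (if y = 1 then (real r + 1) ^ e else 1)"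
proof -
  define f where "f n = q ^ n * (if y = 1 then (real n + 1) ^ e else (1 / (1 - y)) ^ e)" for n
  have f0: "f n \<ge> 0" for n using q y by (simp add: f_def)
  have sum: "summable f"
    using q unfolding f_def by (cases "y = 1") (auto simp: summable_power_mult_poly intro!: summable_mult2 summable_geometric)
  \<comment> \<open>The added 1 makes the constant strictly positive.\<close>
  have pos: "suminf f + 1 > 0" using suminf_nonneg[OF sum f0] by simp
  have G: "(\<Sum>a\<le>m. y ^ a) \<le> 1 / (1 - y)" if "y \<noteq> 1" for m
    using that y sum_le_suminf[of "\<lambda>a. y ^ a" "{..m}"] by (simp add: suminf_geometric)
  have main: "(\<Sum>m=r..N. q ^ m * (\<Sum>a\<le>m. y ^ a) ^ e) \<le> (suminf f + 1) * q ^ r * (if y = 1 then (real r + 1) ^ e else 1)"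
    (is "_ \<le> _ * _ * ?b") for r N
  proof -
    have b0: "?b \<ge> 0" by simp
    have "q ^ m * (\<Sum>a\<le>m. y ^ a) ^ e \<le> q ^ r * ?b * f (m - r)" if m: "m \<ge> r" for m
    proof -
      have qm: "q ^ m = q ^ r * q ^ (m - r)" using m by (simp flip: power_add)
      have "(\<Sum>a\<le>m. y ^ a) ^ e \<le> ?b * (if y = 1 then (real (m - r) + 1) ^ e else (1 / (1 - y)) ^ e)"
      proof (cases "y = 1")
        case True
        have "real m + 1 \<le> (real r + 1) * (real (m - r) + 1)"
        proof -
          obtain n where "m = r + n" using m le_Suc_ex by blast
          then show ?thesis by (simp add: algebra_simps)
        qed
        then have "(real m + 1) ^ e \<le> ((real r + 1) * (real (m - r) + 1)) ^ e"
          by (intro power_mono) auto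
        then show ?thesis using True by (simp add: power_mult_distrib add.commute)
      next
        case False
        then show ?thesis using G[of m] y by (auto intro!: power_mono sum_nonneg)
      qed
      then show ?thesis unfolding qm f_def using q by (simp add: mult_ac)
    qed
    then have "(\<Sum>m=r..N. q ^ m * (\<Sum>a\<le>m. y ^ a) ^ e) \<le> (\<Sum>m=r..N. q ^ r * ?b * f (m - r))"
      by (intro sum_mono) auto
    also have "\<dots> = q ^ r * ?b * (\<Sum>m=r..N. f (m - r))" by (simp add: sum_distrib_left)
    also have "(\<Sum>m=r..N. f (m - r)) = sum f ((\<lambda>m. m - r) ` {r..N})"
      by (subst sum.reindex) (auto simp: inj_on_def)
    also have "\<dots> \<le> suminf f" by (intro sum_le_suminf sum f0) auto
    also have "\<dots> \<le> suminf f + 1" by simp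
    finally show ?thesis using q b0 by (simp add: mult_ac mult_left_mono)
  qed
  show ?thesis by (rule that[OF pos main])
qed

text \<open>The level vectors are grouped by their total \<open>m\<close>. For fixed
  \<open>m\<close> the sum of products is bounded by a power of a univariate sum, and the totals
  then form a tail starting at \<open>r\<close>.\<close>

lemma sum_level_tail_le:
  fixes q y :: real
  assumes q: "0 < q" "q < 1" and y: "0 < y" "y \<le> 1"
  obtains C where "C > 0"
    "\<And>(J :: ('n::finite \<Rightarrow> nat) set) r i. finite J \<Longrightarrow> (\<And>j. j \<in> J \<Longrightarrow> r \<le> (\<Sum>s\<in>UNIV. j s)) \<Longrightarrow>
      (\<Sum>j\<in>J. q ^ (\<Sum>s\<in>UNIV. j s) * (\<Prod>s\<in>UNIV - {i}. y ^ j s))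
        \<le> C * q ^ r * (if y = 1 then (real r + 1) ^ (CARD('n) - 1) else 1)"
proof -
  obtain C where C: "C > 0"
    "\<And>r N. (\<Sum>m=r..N. q ^ m * (\<Sum>a\<le>m. y ^ a) ^ (CARD('n) - 1)) \<le> C * q ^ r * (if y = 1 then (real r + 1) ^ (CARD('n) - 1) else 1)"
    using geometric_tail_le[OF q y, where e = "CARD('n) - 1"] by blast
  show thesis
  proof (rule that[OF C(1)])
    fix J :: "('n \<Rightarrow> nat) set" and r i
    assume J: "finite J" "\<And>j. j \<in> J \<Longrightarrow> r \<le> (\<Sum>s\<in>UNIV. j s)"
    define T where "T j = (\<Sum>s\<in>UNIV. j s)" for j :: "'n \<Rightarrow> nat"
    \<comment> \<open>Inserting 0 keeps the maximum meaningful when \<open>J\<close> is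
      empty.\<close>
    define N where "N = Max (insert 0 (T ` J))"
    have TJ: "T ` J \<subseteq> {r..N}" using J by (auto simp: T_def N_def)
    have "(\<Sum>j\<in>J. q ^ T j * (\<Prod>s\<in>UNIV - {i}. y ^ j s))
        = (\<Sum>m=r..N. \<Sum>j\<in>{j\<in>J. T j = m}. q ^ T j * (\<Prod>s\<in>UNIV - {i}. y ^ j s))"
      by (rule sum.group[symmetric]) (use J(1) TJ in auto)
    also have "\<dots> \<le> (\<Sum>m=r..N. q ^ m * (\<Sum>a\<le>m. y ^ a) ^ (CARD('n) - 1))"
    proof (rule sum_mono)
      fix m
      have "(\<Sum>j\<in>{j\<in>J. T j = m}. q ^ T j * (\<Prod>s\<in>UNIV - {i}. y ^ j s))
          = q ^ m * (\<Sum>j\<in>{j\<in>J. T j = m}. \<Prod>s\<in>UNIV - {i}. y ^ j s)"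
        unfolding sum_distrib_left by (rule sum.cong) auto
      also have "\<dots> \<le> q ^ m * (\<Sum>a\<le>m. y ^ a) ^ (CARD('n) - 1)"
      proof (rule mult_left_mono)
        show "(\<Sum>j\<in>{j\<in>J. T j = m}. \<Prod>s\<in>UNIV - {i}. y ^ j s) \<le> (\<Sum>a\<le>m. y ^ a) ^ (CARD('n) - 1)"
          by (rule sum_prod_fixed_total_le) (use J(1) y in \<open>simp_all add: T_def\<close>)
      qed (use q in simp)
      finally show "(\<Sum>j\<in>{j\<in>J. T j = m}. q ^ T j * (\<Prod>s\<in>UNIV - {i}. y ^ j s))
          \<le> q ^ m * (\<Sum>a\<le>m. y ^ a) ^ (CARD('n) - 1)" .
    qed
    also have "\<dots> \<le> C * q ^ r * (if y = 1 then (real r + 1) ^ (CARD('n) - 1) else 1)" by (rule C(2))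
    finally show "(\<Sum>j\<in>J. q ^ (\<Sum>s\<in>UNIV. j s) * (\<Prod>s\<in>UNIV - {i}. y ^ j s))
        \<le> C * q ^ r * (if y = 1 then (real r + 1) ^ (CARD('n) - 1) else 1)" by (simp add: T_def)
  qed
qed

section \<open>Weights in terms of dyadic levels\<close>

lemma hweight_pos: "hweight a b k > 0"
proof -
  have "1 + (\<Sum>i\<in>UNIV. (real_of_int (k $ i))\<^sup>2) > 0"
    by (intro add_pos_nonneg sum_nonneg) auto
  moreover have "1 + (real_of_int (k $ i))\<^sup>2 > 0" for i
    by (intro add_pos_nonneg) auto
  ultimately show ?thesis
    unfolding hweight_def by (intro mult_pos_pos prod_pos) (auto simp: less_imp_neq[symmetric])
qed

lemma four_powr_nat: "((4::real) ^ n) powr a = (4 powr a) ^ (n :: nat)"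
  by (simp add: powr_powr mult.commute flip: powr_realpow)

lemma prod_weight_le:
  fixes k :: "int ^ 'n"
  assumes "a \<ge> 0"
  shows "(\<Prod>i\<in>UNIV. (1 + (real_of_int (k $ i))\<^sup>2) powr a) \<le> (2 powr a) ^ CARD('n) * (4 powr a) ^ total_level k"
proof -
  have "(\<Prod>i\<in>UNIV. (1 + (real_of_int (k $ i))\<^sup>2) powr a) \<le> (\<Prod>i\<in>UNIV. 2 powr a * (4 powr a) ^ dlevel (k $ i))"
  proof (rule prod_mono, intro conjI)
    fix i
    have "(1 + (real_of_int (k $ i))\<^sup>2) powr a \<le> (2 * 4 ^ dlevel (k $ i)) powr a"
      using assms one_plus_square_le by (intro powr_mono2) auto
    then show "(1 + (real_of_int (k $ i))\<^sup>2) powr a \<le> 2 powr a * (4 powr a) ^ dlevel (k $ i)"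
      by (simp add: powr_mult four_powr_nat)
  qed auto
  then show ?thesis by (simp add: prod.distrib power_sum total_level_def)
qed

lemma prod_weight_minus_le:
  fixes k :: "int ^ 'n"
  assumes "a \<ge> 0"
  shows "(\<Prod>i\<in>UNIV. (1 + (real_of_int (k $ i))\<^sup>2) powr - a) \<le> (4 powr a) ^ CARD('n) * (4 powr - a) ^ total_level k"
proof -
  have "(\<Prod>i\<in>UNIV. (1 + (real_of_int (k $ i))\<^sup>2) powr - a) \<le> (\<Prod>i\<in>UNIV. 4 powr a * (4 powr - a) ^ dlevel (k $ i))"
  proof (rule prod_mono, intro conjI)
    fix i
    have "4 ^ dlevel (k $ i) / 4 \<le> 1 + (real_of_int (k $ i))\<^sup>2"
      using one_plus_square_ge[of "k $ i"] by simp
    then have "(1 + (real_of_int (k $ i))\<^sup>2) powr - a \<le> (4 ^ dlevel (k $ i) / 4) powr - a"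
      using assms by (intro powr_mono2') auto
    also have "\<dots> = 4 powr a * (4 powr - a) ^ dlevel (k $ i)"
      by (simp add: powr_divide four_powr_nat powr_minus field_simps)
    finally show "(1 + (real_of_int (k $ i))\<^sup>2) powr - a \<le> 4 powr a * (4 powr - a) ^ dlevel (k $ i)" .
  qed auto
  then show ?thesis by (simp add: prod.distrib power_sum total_level_def)
qed

text \<open>
  The sum on the right stands for the maximum over the coordinates. It lets the level sums
  below factorise.
\<close>

lemma isotropic_weight_le:
  fixes k :: "int ^ 'n"
  assumes "b \<ge> 0"
  shows "(1 + (\<Sum>i\<in>UNIV. (real_of_int (k $ i))\<^sup>2)) powr b
    \<le> (real CARD('n) + 1) powr b * (\<Sum>i\<in>UNIV. (4 powr b) ^ dlevel (k $ i))"
proof -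
  have "Max (range (\<lambda>s. dlevel (k $ s))) \<in> range (\<lambda>s. dlevel (k $ s))" by (rule Max_in) auto
  then obtain i where "Max (range (\<lambda>s. dlevel (k $ s))) = dlevel (k $ i)" by blast
  then have i: "dlevel (k $ s) \<le> dlevel (k $ i)" for s
    using Max_ge[of "range (\<lambda>s. dlevel (k $ s))" "dlevel (k $ s)"] by simp
  have "(real_of_int (k $ s))\<^sup>2 \<le> 4 ^ dlevel (k $ i)" for s
    by (rule order_trans[OF square_le power_increasing[OF i]]) simp
  then have "(\<Sum>s\<in>UNIV. (real_of_int (k $ s))\<^sup>2) \<le> real CARD('n) * 4 ^ dlevel (k $ i)"
    using sum_bounded_above[of UNIV "\<lambda>s. (real_of_int (k $ s))\<^sup>2"] by simp
  moreover have "(1::real) \<le> 4 ^ dlevel (k $ i)" by simp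
  ultimately have "1 + (\<Sum>s\<in>UNIV. (real_of_int (k $ s))\<^sup>2) \<le> (real CARD('n) + 1) * 4 ^ dlevel (k $ i)"
    unfolding distrib_right mult_1_left by linarith
  then have "(1 + (\<Sum>s\<in>UNIV. (real_of_int (k $ s))\<^sup>2)) powr b \<le> ((real CARD('n) + 1) * 4 ^ dlevel (k $ i)) powr b"
    using assms by (intro powr_mono2) (auto intro!: add_nonneg_nonneg sum_nonneg)
  also have "\<dots> = (real CARD('n) + 1) powr b * (4 powr b) ^ dlevel (k $ i)"
    by (simp add: powr_mult four_powr_nat)
  also have "\<dots> \<le> (real CARD('n) + 1) powr b * (\<Sum>s\<in>UNIV. (4 powr b) ^ dlevel (k $ s))"
    by (intro mult_left_mono member_le_sum) auto
  finally show ?thesis .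
qed

lemma inverse_hweight_le:
  fixes k :: "int ^ 'n"
  assumes "\<alpha> \<ge> 0" "\<beta> \<le> 0"
  shows "1 / hweight \<alpha> \<beta> k \<le> (real CARD('n) + 1) powr - \<beta> * (4 powr \<alpha>) ^ CARD('n) *
    (4 powr - \<alpha>) ^ total_level k * (\<Sum>i\<in>UNIV. (4 powr - \<beta>) ^ dlevel (k $ i))"
proof -
  have "1 / hweight \<alpha> \<beta> k = (1 + (\<Sum>i\<in>UNIV. (real_of_int (k $ i))\<^sup>2)) powr - \<beta> *
      (\<Prod>i\<in>UNIV. (1 + (real_of_int (k $ i))\<^sup>2) powr - \<alpha>)"
    by (simp add: hweight_def powr_minus prod_inversef[symmetric] o_def divide_inverse)
  also have "\<dots> \<le> ((real CARD('n) + 1) powr - \<beta> * (\<Sum>i\<in>UNIV. (4 powr - \<beta>) ^ dlevel (k $ i))) *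
      ((4 powr \<alpha>) ^ CARD('n) * (4 powr - \<alpha>) ^ total_level k)"
    using assms by (intro mult_mono isotropic_weight_le prod_weight_minus_le mult_nonneg_nonneg sum_nonneg prod_nonneg) auto
  finally show ?thesis by (simp only: mult_ac)
qed

text \<open>Grouping by level vectors reduces the sum to block cardinalities times level-wise bounds
  on the inverse weights. The density \<open>c\<close> and the minimal level \<open>r\<close> are
  left abstract because the result serves both for all frequencies, with \<open>r = 0\<close>, and
  for cosets of the dual lattice outside the cross.\<close>

lemma sum_inverse_hweight_le:
  fixes \<alpha> \<beta> :: real
  assumes \<alpha>: "\<alpha> \<ge> 0" and \<beta>: "\<beta> \<le> 0" and \<alpha>\<beta>: "\<alpha> + \<beta> > 1 / 2"
  obtains C where "C > 0"
    "\<And>(F :: (int ^ 'n) set) r c. finite F \<Longrightarrow> 0 \<le> c \<Longrightarrow> (\<And>h. h \<in> F \<Longrightarrow> r \<le> total_level h) \<Longrightarrow>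
      (\<And>j. r \<le> (\<Sum>i\<in>UNIV. j i) \<Longrightarrow> real (card (F \<inter> dyadic_box j)) \<le> c * 2 ^ (\<Sum>i\<in>UNIV. j i)) \<Longrightarrow>
      (\<Sum>h\<in>F. 1 / hweight \<alpha> \<beta> h)
        \<le> C * c * (2 * 4 powr - (\<alpha> + \<beta>)) ^ r * (if \<beta> = 0 then (real r + 1) ^ (CARD('n) - 1) else 1)"
proof -
  \<comment> \<open>Per level, block cardinalities grow by 2 while the inverse weight decays at
    least like \<open>4 powr - (\<alpha> + \<beta>)\<close>, its rate along an axis. The factor
    \<open>y\<close> is the additional decay for levels in the coordinates other than the
    distinguished one.\<close>
  define q where "q = 2 * 4 powr - (\<alpha> + \<beta>)"
  define y where "y = 4 powr \<beta>"
  have "(4 :: real) powr - (\<alpha> + \<beta>) < 4 powr - (1 / 2)" using \<alpha>\<beta> by (intro powr_less_mono) auto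
  also have "\<dots> = 1 / 2" by (simp add: powr_minus powr_half_sqrt)
  finally have q: "0 < q" "q < 1" by (auto simp: q_def)
  have y: "0 < y" "y \<le> 1" using \<beta> using powr_mono[OF \<beta>, of 4] by (auto simp: y_def)
  have y1: "y = 1 \<longleftrightarrow> \<beta> = 0" by (simp add: y_def)
  obtain C where C: "C > 0"
    "\<And>(J :: ('n::finite \<Rightarrow> nat) set) r i. finite J \<Longrightarrow> (\<And>j. j \<in> J \<Longrightarrow> r \<le> (\<Sum>s\<in>UNIV. j s)) \<Longrightarrow>
      (\<Sum>j\<in>J. q ^ (\<Sum>s\<in>UNIV. j s) * (\<Prod>s\<in>UNIV - {i}. y ^ j s))
        \<le> C * q ^ r * (if y = 1 then (real r + 1) ^ (CARD('n) - 1) else 1)"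
    using sum_level_tail_le[OF q y] by blast
  define A where "A = (real CARD('n) + 1) powr - \<beta> * (4 powr \<alpha>) ^ CARD('n)"
  have A: "A > 0" by (simp add: A_def)
  show thesis
  proof (rule that[of "real CARD('n) * A * C"])
    show "real CARD('n) * A * C > 0" using A C by simp
    fix F :: "(int ^ 'n) set" and r c
    assume F: "finite F" and c: "0 \<le> c" and r: "\<And>h. h \<in> F \<Longrightarrow> r \<le> total_level h"
      and card: "\<And>j. r \<le> (\<Sum>i\<in>UNIV. j i) \<Longrightarrow> real (card (F \<inter> dyadic_box j)) \<le> c * 2 ^ (\<Sum>i\<in>UNIV. j i)"
    define L where "L h = (\<lambda>i. dlevel (h $ i))" for h :: "int ^ 'n"
    have TL: "total_level h = (\<Sum>i\<in>UNIV. L h i)" for h by (simp add: total_level_def L_def)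
    let ?T = "\<lambda>j :: 'n \<Rightarrow> nat. \<Sum>i\<in>UNIV. j i"
    define b where "b j = A * (4 powr - \<alpha>) ^ ?T j * (\<Sum>i\<in>UNIV. (4 powr - \<beta>) ^ j i)" for j :: "'n \<Rightarrow> nat"
    have b0: "b j \<ge> 0" for j using A by (auto simp: b_def intro!: sum_nonneg mult_nonneg_nonneg)
    have "(\<Sum>h\<in>F. 1 / hweight \<alpha> \<beta> h) \<le> (\<Sum>h\<in>F. b (L h))"
    proof (rule sum_mono)
      fix h
      show "1 / hweight \<alpha> \<beta> h \<le> b (L h)"
        using inverse_hweight_le[OF \<alpha> \<beta>, of h] by (simp add: b_def A_def total_level_def L_def)
    qed
    also have "\<dots> = (\<Sum>j\<in>L ` F. \<Sum>h\<in>{h\<in>F. L h = j}. b (L h))"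
      by (rule sum.group[symmetric]) (use F in auto)
    also have "\<dots> = (\<Sum>j\<in>L ` F. real (card {h\<in>F. L h = j}) * b j)"
      by (rule sum.cong) auto
    also have "\<dots> \<le> (\<Sum>j\<in>L ` F. c * 2 ^ ?T j * b j)"
    proof (intro sum_mono mult_right_mono b0)
      fix j assume "j \<in> L ` F"
      then have "r \<le> ?T j" using r by (auto simp: TL)
      have "real (card {h\<in>F. L h = j}) \<le> real (card (F \<inter> dyadic_box j))"
        using F by (intro of_nat_mono card_mono) (auto simp: mem_dyadic_box_iff L_def)
      also have "\<dots> \<le> c * 2 ^ ?T j" by (rule card[OF \<open>r \<le> ?T j\<close>])
      finally show "real (card {h\<in>F. L h = j}) \<le> c * 2 ^ ?T j" .
    qed
    also have "\<dots> = (\<Sum>j\<in>L ` F. \<Sum>i\<in>UNIV. c * A * (q ^ ?T j * (\<Prod>s\<in>UNIV - {i}. y ^ j s)))"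
    proof (rule sum.cong[OF refl])
      fix j :: "'n \<Rightarrow> nat"
      \<comment> \<open>The isotropic factor \<open>(4 powr - \<beta>) ^ j i\<close> cancels the
        factor of \<open>y ^ ?T j\<close> at coordinate \<open>i\<close>.\<close>
      have "2 ^ ?T j * (4 powr - \<alpha>) ^ ?T j * (4 powr - \<beta>) ^ j i = q ^ ?T j * (\<Prod>s\<in>UNIV - {i}. y ^ j s)" for i
      proof -
        have "?T j = j i + (\<Sum>s\<in>UNIV - {i}. j s)" by (simp add: sum.remove[of UNIV i])
        then have "y ^ ?T j = y ^ j i * (\<Prod>s\<in>UNIV - {i}. y ^ j s)" by (simp add: power_add power_sum)
        moreover have "(4 powr - \<beta>) ^ j i * y ^ j i = 1"
          by (simp add: y_def powr_minus flip: power_mult_distrib)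
        moreover have "2 * 4 powr - \<alpha> = q * y" by (simp add: q_def y_def flip: powr_add)
        then have "2 ^ ?T j * (4 powr - \<alpha>) ^ ?T j = q ^ ?T j * y ^ ?T j"
          by (simp flip: power_mult_distrib)
        ultimately show ?thesis by (simp add: algebra_simps)
      qed
      then show "c * 2 ^ ?T j * b j = (\<Sum>i\<in>UNIV. c * A * (q ^ ?T j * (\<Prod>s\<in>UNIV - {i}. y ^ j s)))"
        unfolding b_def sum_distrib_left by (intro sum.cong) (simp_all add: mult_ac)
    qed
    also have "\<dots> = (\<Sum>i\<in>UNIV. c * A * (\<Sum>j\<in>L ` F. q ^ ?T j * (\<Prod>s\<in>UNIV - {i}. y ^ j s)))"
      by (subst sum.swap) (simp add: sum_distrib_left)
    also have "\<dots> \<le> (\<Sum>i\<in>(UNIV :: 'n set). c * A * (C * q ^ r * (if y = 1 then (real r + 1) ^ (CARD('n) - 1) else 1)))"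
      using c A F r by (intro sum_mono mult_left_mono C(2)) (auto simp: TL)
    also have "\<dots> = real CARD('n) * A * C * c * (2 * 4 powr - (\<alpha> + \<beta>)) ^ r * (if \<beta> = 0 then (real r + 1) ^ (CARD('n) - 1) else 1)"
      by (simp add: y1 q_def)
    finally show "(\<Sum>h\<in>F. 1 / hweight \<alpha> \<beta> h) \<le> real CARD('n) * A * C * c * (2 * 4 powr - (\<alpha> + \<beta>)) ^ r * (if \<beta> = 0 then (real r + 1) ^ (CARD('n) - 1) else 1)" .
  qed
qed

section \<open>Aliasing\<close>

text \<open>The dual lattice consists of the \<open>k\<close> with
  \<open>int M dvd zdot z k\<close>; its cosets are the sets of frequencies that coincide at all
  nodes.\<close>

definition zdot :: "int ^ 'n \<Rightarrow> int ^ 'n \<Rightarrow> int" where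
  "zdot z k = (\<Sum>i\<in>UNIV. k $ i * z $ i)"

lemma zdot_diff: "zdot z (k - l) = zdot z k - zdot z l"
  by (simp add: zdot_def left_diff_distrib sum_subtractf)

lemma zdot_0 [simp]: "zdot z 0 = 0"
  by (simp add: zdot_def)

lemma zdot_axis: "zdot z (axis i c) = c * z $ i"
proof -
  have "zdot z (axis i c) = (\<Sum>j\<in>UNIV. if j = i then c * z $ i else 0)"
    unfolding zdot_def by (rule sum.cong) (auto simp: axis_def)
  then show ?thesis by simp
qed

lemma fdot_lattice_node: "fdot k (lattice_node z M j) = real j * of_int (zdot z k) / real M"
  by (simp add: fdot_def lattice_node_def zdot_def sum_distrib_left sum_divide_distrib mult_ac)

lemma fexp_lattice_node_cong:
  assumes "M > 0" "int M dvd zdot z k - zdot z l"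
  shows "fexp k (lattice_node z M j) = fexp l (lattice_node z M j)"
proof -
  from assms(2) obtain c where c: "zdot z k = zdot z l + int M * c"
    by (metis add.commute diff_add_cancel dvdE)
  have "2 * pi * fdot k (lattice_node z M j) = 2 * pi * fdot l (lattice_node z M j) + 2 * pi * of_int (int j * c)"
    using assms(1) by (simp add: fdot_lattice_node c field_simps)
  then show ?thesis by (simp only: cis_mult[symmetric] cis_int_multiple mult_1_right)
qed

text \<open>A geometric sum of powers of an \<open>M\<close>-th root of unity \<open>w\<close>,
  which equals 1 exactly when \<open>M\<close> divides \<open>n\<close>.\<close>

lemma sum_cis_roots:
  assumes "M > 0"
  shows "(\<Sum>j<M. cis (2 * pi * (real j * of_int n / real M))) = (if int M dvd n then of_nat M else 0)"
proof -
  define w where "w = cis (2 * pi * of_int n / real M)"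
  have pw: "cis (2 * pi * (real j * of_int n / real M)) = w ^ j" for j
  proof -
    have "2 * pi * (real j * of_int n / real M) = real j * (2 * pi * of_int n / real M)" by simp
    then show ?thesis by (simp only: w_def Complex.DeMoivre)
  qed
  have sum_w: "(\<Sum>j<M. cis (2 * pi * (real j * of_int n / real M))) = (\<Sum>j<M. w ^ j)"
    by (simp only: pw)
  have wM: "w ^ M = 1"
    using assms cis_int_multiple[of n] by (simp add: w_def Complex.DeMoivre)
  show ?thesis
  proof (cases "int M dvd n")
    case True
    then obtain c where "n = int M * c" by (elim dvdE)
    then have "w = 1" using assms cis_int_multiple[of c] by (simp add: w_def mult.assoc)
    then show ?thesis unfolding sum_w using True by simp
  next
    case False
    have "w \<noteq> 1"
    proof
      assume "w = 1"
      then have "cos (2 * pi * of_int n / real M) = 1" by (metis w_def cis.sel(1) one_complex.sel(1))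
      then obtain m :: int where "2 * pi * of_int n / real M = of_int m * 2 * pi"
        unfolding cos_one_2pi_int by blast
      then have "2 * pi * of_int n = 2 * pi * (of_int m * real M)" using assms by (simp add: field_simps)
      then have "real_of_int n = of_int (m * int M)" by simp
      then have "n = m * int M" by (simp only: of_int_eq_iff)
      with False show False by simp
    qed
    then show ?thesis unfolding sum_w using False by (simp add: geometric_sum wM)
  qed
qed

lemma lattice_coeff_fexp:
  assumes "M > 0"
  shows "lattice_coeff z M (fexp h) k = (if int M dvd zdot z h - zdot z k then 1 else 0)"
proof -
  have "lattice_coeff z M (fexp h) k = (\<Sum>j<M. cis (2 * pi * (real j * of_int (zdot z h - zdot z k) / real M))) / of_nat M"
    by (simp add: lattice_coeff_def fdot_lattice_node cis_mult ring_distribs diff_divide_distrib)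
  then show ?thesis using assms by (simp only: sum_cis_roots) simp
qed

lemma has_sum_finite_sum:
  fixes f :: "'b \<Rightarrow> 'a \<Rightarrow> complex"
  assumes "finite J" "\<And>j. j \<in> J \<Longrightarrow> (f j has_sum s j) A"
  shows "((\<lambda>x. \<Sum>j\<in>J. f j x) has_sum (\<Sum>j\<in>J. s j)) A"
  using assms by (induction J rule: finite_induct) (auto intro!: has_sum_add)

text \<open>A lattice coefficient is a finite combination of point values, so it can be applied
  termwise to the pointwise series. On a single exponential it is the indicator of the coset of
  \<open>k\<close>.\<close>

lemma aliasing:
  fixes f :: "real ^ 'n \<Rightarrow> complex"
  assumes "M > 0" and f: "\<And>x. ((\<lambda>h. c h * fexp h x) has_sum f x) UNIV"
  shows "((\<lambda>h. if int M dvd zdot z h - zdot z k then c h else 0) has_sum lattice_coeff z M f k) UNIV"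
proof -
  have "((\<lambda>h. (\<Sum>j<M. c h * fexp h (lattice_node z M j) * cis (- 2 * pi * fdot k (lattice_node z M j))) * inverse (of_nat M))
      has_sum (\<Sum>j<M. f (lattice_node z M j) * cis (- 2 * pi * fdot k (lattice_node z M j))) * inverse (of_nat M)) UNIV"
    by (intro has_sum_cmult_left has_sum_finite_sum f) auto
  moreover have "(\<Sum>j<M. c h * fexp h (lattice_node z M j) * cis (- 2 * pi * fdot k (lattice_node z M j))) * inverse (of_nat M)
      = c h * lattice_coeff z M (fexp h) k" for h
    by (simp add: lattice_coeff_def sum_distrib_left mult.assoc divide_inverse)
  ultimately show ?thesis
    by (simp add: lattice_coeff_fexp[OF assms(1)] if_distrib[of "(*) _"] cong: if_cong)
       (simp add: lattice_coeff_def divide_inverse)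
qed

text \<open>Sampling the exponential at \<open>k\<close> would otherwise also produce the
  coefficient 1 at \<open>l\<close>, contradicting reconstruction.\<close>

lemma reconstructing_distinct:
  fixes I :: "(int ^ 'n) set"
  assumes rec: "reconstructing I z M" and "finite I" "k \<in> I" "l \<in> I"
    and dvd: "int M dvd zdot z k - zdot z l"
  shows "k = l"
proof (rule ccontr)
  assume "k \<noteq> l"
  have "M > 0" using rec by (simp add: reconstructing_def)
  define c where "c h = (if h = k then 1 else 0 :: complex)" for h
  have "trig_poly I c = fexp k"
    using assms(2,3) by (auto simp: trig_poly_def c_def fun_eq_iff if_distrib[of "\<lambda>x. x * _"] cong: if_cong)
  moreover have "sampling_op I z M (trig_poly I c) = trig_poly I c"
    using rec by (simp add: reconstructing_def)
  ultimately have "fourier_coeff (trig_poly I (lattice_coeff z M (fexp k))) l = fourier_coeff (fexp k) l"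
    by (simp add: sampling_op_def)
  then show False
    using assms \<open>k \<noteq> l\<close> \<open>M > 0\<close> by (simp add: fourier_coeff_trig_poly fourier_coeff_fexp lattice_coeff_fexp)
qed

text \<open>Weighted Cauchy-Schwarz on each \<open>X k\<close> bounds the square by \<open>W\<close>
  times the energy of \<open>c\<close> on \<open>X k\<close>. Everything is done for a finite set
  \<open>H\<close> of frequencies, and the limit is taken at the end.\<close>

lemma sum_coset_sq_le:
  fixes c :: "'k \<Rightarrow> complex" and w :: "'k \<Rightarrow> real" and X :: "'i \<Rightarrow> 'k set"
  assumes I: "finite I" and dis: "disjoint_family_on X I" and w: "\<And>h. w h > 0"
    and W: "\<And>k H. k \<in> I \<Longrightarrow> finite H \<Longrightarrow> H \<subseteq> X k \<Longrightarrow> (\<Sum>h\<in>H. 1 / w h) \<le> W"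
    and c: "\<And>H. finite H \<Longrightarrow> (\<Sum>h\<in>H. (cmod (c h))\<^sup>2 * w h) \<le> 1"
    and D: "\<And>k. k \<in> I \<Longrightarrow> ((\<lambda>h. if h \<in> X k then c h else 0) has_sum D k) UNIV"
    and "W \<ge> 0"
  shows "(\<Sum>k\<in>I. (cmod (D k))\<^sup>2) \<le> W"
proof (rule tendsto_upperbound)
  show "((\<lambda>H. \<Sum>k\<in>I. (cmod (\<Sum>h\<in>H. if h \<in> X k then c h else 0))\<^sup>2) \<longlongrightarrow> (\<Sum>k\<in>I. (cmod (D k))\<^sup>2)) (finite_subsets_at_top UNIV)"
    using D unfolding has_sum_def by (intro tendsto_intros) auto
  have "(\<Sum>k\<in>I. (cmod (\<Sum>h\<in>H. if h \<in> X k then c h else 0))\<^sup>2) \<le> W" if H: "finite H" for H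
  proof -
    have "(cmod (\<Sum>h\<in>H. if h \<in> X k then c h else 0))\<^sup>2 \<le> W * (\<Sum>h\<in>H \<inter> X k. (cmod (c h))\<^sup>2 * w h)" if k: "k \<in> I" for k
    proof -
      have "cmod (\<Sum>h\<in>H. if h \<in> X k then c h else 0) = cmod (\<Sum>h\<in>H \<inter> X k. c h)"
        using H by (simp add: sum.inter_restrict)
      also have "\<dots> \<le> (\<Sum>h\<in>H \<inter> X k. cmod (c h))" by (rule norm_sum)
      also have "\<dots> = (\<Sum>h\<in>H \<inter> X k. (1 / sqrt (w h)) * (cmod (c h) * sqrt (w h)))"
        using w by (intro sum.cong) (auto simp: less_imp_neq[symmetric])
      finally have "(cmod (\<Sum>h\<in>H. if h \<in> X k then c h else 0))\<^sup>2 \<le> (\<Sum>h\<in>H \<inter> X k. (1 / sqrt (w h)) * (cmod (c h) * sqrt (w h)))\<^sup>2"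
        by (intro power_mono) auto
      also have "\<dots> \<le> (\<Sum>h\<in>H \<inter> X k. (1 / sqrt (w h))\<^sup>2) * (\<Sum>h\<in>H \<inter> X k. (cmod (c h) * sqrt (w h))\<^sup>2)"
        by (rule Cauchy_Schwarz_ineq_sum)
      also have "\<dots> = (\<Sum>h\<in>H \<inter> X k. 1 / w h) * (\<Sum>h\<in>H \<inter> X k. (cmod (c h))\<^sup>2 * w h)"
        using w by (simp add: power_divide power_mult_distrib less_imp_le)
      also have "\<dots> \<le> W * (\<Sum>h\<in>H \<inter> X k. (cmod (c h))\<^sup>2 * w h)"
        using H k w by (intro mult_right_mono W sum_nonneg) (auto simp: less_imp_le)
      finally show ?thesis .
    qed
    then have "(\<Sum>k\<in>I. (cmod (\<Sum>h\<in>H. if h \<in> X k then c h else 0))\<^sup>2) \<le> (\<Sum>k\<in>I. W * (\<Sum>h\<in>H \<inter> X k. (cmod (c h))\<^sup>2 * w h))"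
      by (rule sum_mono)
    \<comment> \<open>Disjointness merges the energies on the individual sets into one sum, which is
      at most 1.\<close>
    also have "\<dots> = W * (\<Sum>h\<in>(\<Union>k\<in>I. H \<inter> X k). (cmod (c h))\<^sup>2 * w h)"
      using I H dis by (subst sum.UNION_disjoint) (auto simp: disjoint_family_on_def sum_distrib_left)
    also have "\<dots> \<le> W * 1"
      using \<open>W \<ge> 0\<close> H by (intro mult_left_mono c finite_subset[OF _ H]) auto
    finally show ?thesis by simp
  qed
  then show "\<forall>\<^sub>F H in finite_subsets_at_top UNIV. (\<Sum>k\<in>I. (cmod (\<Sum>h\<in>H. if h \<in> X k then c h else 0))\<^sup>2) \<le> W"
    by (intro eventually_finite_subsets_at_top_weakI)
qed simp

section \<open>Comparison of the source and target weights\<close>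

lemma hweight_0: "hweight \<gamma> 0 k = (\<Prod>i\<in>UNIV. (1 + (real_of_int (k $ i))\<^sup>2) powr \<gamma>)"
proof -
  have "1 + (\<Sum>i\<in>UNIV. (real_of_int (k $ i))\<^sup>2) > 0"
    by (intro add_pos_nonneg sum_nonneg) auto
  then show ?thesis by (simp add: hweight_def less_imp_neq[symmetric])
qed

lemma one_plus_sum_le_prod:
  fixes x :: "'i \<Rightarrow> real"
  assumes "finite A" "\<And>i. x i \<ge> 0"
  shows "1 + (\<Sum>i\<in>A. x i) \<le> (\<Prod>i\<in>A. 1 + x i)"
  using assms
proof (induction A rule: finite_induct)
  case (insert a A)
  have "1 + (\<Sum>i\<in>insert a A. x i) \<le> (1 + x a) * (1 + (\<Sum>i\<in>A. x i))"
    using insert by (simp add: algebra_simps sum_nonneg)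
  also have "\<dots> \<le> (1 + x a) * (\<Prod>i\<in>A. 1 + x i)" using insert by (intro mult_left_mono) auto
  finally show ?case using insert by simp
qed simp

text \<open>Since \<open>1 + (sum of squares)\<close> is at most the product of the
  \<open>1 + square\<close> and \<open>\<beta> \<le> 0\<close>, the source weight dominates the
  mixed weight of order \<open>\<alpha> + \<beta>\<close>. The remaining mixed factor of order
  \<open>- (\<alpha> + \<beta> - \<gamma>)\<close> decays with the total level.\<close>

lemma weight_quotient_le:
  fixes k :: "int ^ 'n"
  assumes "\<beta> \<le> 0" "\<alpha> + \<beta> - \<gamma> \<ge> 0"
  shows "hweight \<gamma> 0 k \<le> (4 powr (\<alpha> + \<beta> - \<gamma>)) ^ CARD('n) * (4 powr - (\<alpha> + \<beta> - \<gamma>)) ^ total_level k * hweight \<alpha> \<beta> k"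
proof -
  let ?x = "\<lambda>i. 1 + (real_of_int (k $ i))\<^sup>2"
  have x: "?x i > 0" for i by (intro add_pos_nonneg) auto
  have s: "1 + (\<Sum>i\<in>UNIV. (real_of_int (k $ i))\<^sup>2) > 0"
    by (intro add_pos_nonneg sum_nonneg) auto
  have "(\<Prod>i\<in>UNIV. ?x i) powr \<beta> \<le> (1 + (\<Sum>i\<in>UNIV. (real_of_int (k $ i))\<^sup>2)) powr \<beta>"
    using assms s by (intro powr_mono2' one_plus_sum_le_prod) auto
  then have "(\<Prod>i\<in>UNIV. ?x i powr \<beta>) * (\<Prod>i\<in>UNIV. ?x i powr \<alpha>) \<le> hweight \<alpha> \<beta> k"
    unfolding hweight_def using x
    by (intro mult_right_mono prod_nonneg) (auto simp: prod_powr_distrib less_imp_le)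
  then have w: "(\<Prod>i\<in>UNIV. ?x i powr (\<alpha> + \<beta>)) \<le> hweight \<alpha> \<beta> k"
    by (simp add: powr_add mult.commute flip: prod.distrib)
  have "hweight \<gamma> 0 k = (\<Prod>i\<in>UNIV. ?x i powr - (\<alpha> + \<beta> - \<gamma>)) * (\<Prod>i\<in>UNIV. ?x i powr (\<alpha> + \<beta>))"
    unfolding hweight_0 by (simp flip: prod.distrib powr_add)
  also have "\<dots> \<le> ((4 powr (\<alpha> + \<beta> - \<gamma>)) ^ CARD('n) * (4 powr - (\<alpha> + \<beta> - \<gamma>)) ^ total_level k) * hweight \<alpha> \<beta> k"
    using assms(2) w by (intro mult_mono prod_weight_minus_le) (auto intro!: prod_nonneg mult_nonneg_nonneg)
  finally show ?thesis .
qed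

section \<open>Upper bound\<close>

text \<open>With \<open>w\<close> the weight, \<open>cmod c \<le> (cmod c)^2 * w + 1 / w\<close>
  termwise. The inverse weights are summable by the level estimate with \<open>r = 0\<close>, where
  the cardinality of a full box serves as counting bound.\<close>

lemma summable_fourier_coeff:
  fixes f :: "real ^ 'n \<Rightarrow> complex"
  assumes \<alpha>: "\<alpha> \<ge> 0" and \<beta>: "\<beta> \<le> 0" and \<alpha>\<beta>: "\<alpha> + \<beta> > 1 / 2" and f: "f \<in> hspace \<alpha> \<beta>"
  shows "(\<lambda>k. cmod (fourier_coeff f k)) summable_on UNIV"
proof -
  obtain C where "C > 0" and C: "\<And>(F :: (int ^ 'n) set) r c. finite F \<Longrightarrow> 0 \<le> c \<Longrightarrow> (\<And>h. h \<in> F \<Longrightarrow> r \<le> total_level h) \<Longrightarrow>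
      (\<And>j. r \<le> (\<Sum>i\<in>UNIV. j i) \<Longrightarrow> real (card (F \<inter> dyadic_box j)) \<le> c * 2 ^ (\<Sum>i\<in>UNIV. j i)) \<Longrightarrow>
      (\<Sum>h\<in>F. 1 / hweight \<alpha> \<beta> h)
        \<le> C * c * (2 * 4 powr - (\<alpha> + \<beta>)) ^ r * (if \<beta> = 0 then (real r + 1) ^ (CARD('n) - 1) else 1)"
    using sum_inverse_hweight_le[OF \<alpha> \<beta> \<alpha>\<beta>] by blast
  have bound: "(\<Sum>h\<in>F. 1 / hweight \<alpha> \<beta> h) \<le> C * 3 ^ CARD('n)" if F: "finite F" for F :: "(int ^ 'n) set"
  proof -
    have "(\<Sum>h\<in>F. 1 / hweight \<alpha> \<beta> h)
        \<le> C * 3 ^ CARD('n) * (2 * 4 powr - (\<alpha> + \<beta>)) ^ 0 * (if \<beta> = 0 then (real 0 + 1) ^ (CARD('n) - 1) else 1)"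
    proof (rule C[OF F])
      fix j :: "'n \<Rightarrow> nat"
      have "real (card (F \<inter> dyadic_box j)) \<le> real (card (dyadic_box j))"
        by (intro of_nat_mono card_mono finite_dyadic_box) auto
      also have "\<dots> \<le> 3 ^ CARD('n) * 2 ^ (\<Sum>i\<in>UNIV. j i)" by (rule card_dyadic_box_le)
      finally show "real (card (F \<inter> dyadic_box j)) \<le> 3 ^ CARD('n) * 2 ^ (\<Sum>i\<in>UNIV. j i)" .
    qed auto
    then show ?thesis by (cases "\<beta> = 0") simp_all
  qed
  have "(\<lambda>k. 1 / hweight \<alpha> \<beta> (k :: int ^ 'n)) summable_on UNIV"
    by (rule nonneg_bdd_above_summable_on)
       (auto intro!: bdd_aboveI2[where M = "C * 3 ^ CARD('n)"] bound less_imp_le[OF hweight_pos])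
  moreover have "(\<lambda>k. (cmod (fourier_coeff f k))\<^sup>2 * hweight \<alpha> \<beta> k) summable_on UNIV"
    using f by (simp add: hspace_def)
  ultimately have "(\<lambda>k. (cmod (fourier_coeff f k))\<^sup>2 * hweight \<alpha> \<beta> k + 1 / hweight \<alpha> \<beta> k) summable_on UNIV"
    by (intro summable_on_add)
  then show ?thesis
  proof (rule summable_on_comparison_test)
    fix k :: "int ^ 'n"
    define s where "s = sqrt (hweight \<alpha> \<beta> k)"
    have s: "s > 0" "hweight \<alpha> \<beta> k = s\<^sup>2" using hweight_pos[of \<alpha> \<beta> k] by (auto simp: s_def less_imp_le)
    have "0 \<le> (cmod (fourier_coeff f k) * s - 1 / s)\<^sup>2 + (cmod (fourier_coeff f k) * s)\<^sup>2 + (1 / s)\<^sup>2"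
      by (intro add_nonneg_nonneg) auto
    also have "\<dots> = 2 * ((cmod (fourier_coeff f k) * s)\<^sup>2 + (1 / s)\<^sup>2 - (cmod (fourier_coeff f k) * s) * (1 / s))"
      by (simp add: power2_diff)
    also have "(cmod (fourier_coeff f k) * s) * (1 / s) = cmod (fourier_coeff f k)" using s by simp
    finally show "cmod (fourier_coeff f k) \<le> (cmod (fourier_coeff f k))\<^sup>2 * hweight \<alpha> \<beta> k + 1 / hweight \<alpha> \<beta> k"
      using s by (simp add: power_mult_distrib power_divide)
  qed auto
qed

lemma L2_torus_of_continuous:
  assumes "continuous_on UNIV f" "periodic1 f"
  shows "f \<in> L2_torus"
  using assms unfolding L2_torus_def
  by (auto intro!: borel_measurable_continuous_onI set_integrable_unit_cube continuous_intros)

text \<open>A uniform bound on finite partial sums gives membership in the space together with the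
  norm bound, so the value \<open>\<infinity>\<close> is excluded.\<close>

lemma hnorm_leI:
  assumes "continuous_on UNIV g" "periodic1 g"
    and bound: "\<And>F. finite F \<Longrightarrow> (\<Sum>k\<in>F. (cmod (fourier_coeff g k))\<^sup>2 * hweight a b k) \<le> E"
  shows "hnorm a b g \<le> ennreal (sqrt E)"
proof -
  have s: "(\<lambda>k. (cmod (fourier_coeff g k))\<^sup>2 * hweight a b k) summable_on UNIV"
    by (rule nonneg_bdd_above_summable_on)
       (auto intro!: bdd_aboveI2[where M = E] bound mult_nonneg_nonneg less_imp_le[OF hweight_pos])
  then have "g \<in> hspace a b"
    using L2_torus_of_continuous[OF assms(1,2)] by (simp add: hspace_def)
  moreover have "(\<Sum>\<^sub>\<infinity>k. (cmod (fourier_coeff g k))\<^sup>2 * hweight a b k) \<le> E"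
    using s bound by (rule infsum_le_finite_sums)
  ultimately show ?thesis by (simp add: hnorm_def ennreal_leI)
qed

text \<open>Outside \<open>I\<close> the error coefficients are those of \<open>f\<close>, and
  \<open>A\<close> bounds this truncation part. Inside \<open>I\<close> they are aliasing terms
  \<open>- D k\<close>, whose squares sum to at most \<open>W\<close> and carry target weights at
  most \<open>V\<close>.\<close>

lemma hnorm_error_le:
  fixes f :: "real ^ 'n \<Rightarrow> complex"
  assumes params: "\<alpha> \<ge> 0" "\<beta> \<le> 0" "\<alpha> + \<beta> > 1 / 2"
    and rec: "reconstructing I z M" and I: "finite I"
    and f: "f \<in> hspace_cont \<alpha> \<beta>" "hnorm \<alpha> \<beta> f \<le> 1"
    and A: "A \<ge> 0" "\<And>k. k \<notin> I \<Longrightarrow> hweight \<gamma> 0 k \<le> A * hweight \<alpha> \<beta> k"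
    and V: "V \<ge> 0" "\<And>k. k \<in> I \<Longrightarrow> hweight \<gamma> 0 k \<le> V"
    and W: "W \<ge> 0" "\<And>k H. k \<in> I \<Longrightarrow> finite H \<Longrightarrow> H \<subseteq> {h. int M dvd zdot z h - zdot z k} - I \<Longrightarrow>
      (\<Sum>h\<in>H. 1 / hweight \<alpha> \<beta> h) \<le> W"
  shows "hnorm \<gamma> 0 (\<lambda>x. f x - sampling_op I z M f x) \<le> ennreal (sqrt (A + V * W))"
proof (rule hnorm_leI)
  have M: "M > 0" using rec by (simp add: reconstructing_def)
  have cont: "continuous_on UNIV f" and per: "periodic1 f" and hs: "f \<in> hspace \<alpha> \<beta>"
    using f(1) by (auto simp: hspace_cont_def hspace_def L2_torus_def)
  show "continuous_on UNIV (\<lambda>x. f x - sampling_op I z M f x)"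
    unfolding sampling_op_def by (intro continuous_intros cont)
  show "periodic1 (\<lambda>x. f x - sampling_op I z M f x)"
    using per periodic1_trig_poly unfolding sampling_op_def periodic1_def by metis
  let ?c = "fourier_coeff f" and ?w = "hweight \<alpha> \<beta>"
  have summ: "(\<lambda>k. (cmod (?c k))\<^sup>2 * ?w k) summable_on UNIV" using hs by (simp add: hspace_def)
  have nonneg: "(cmod (?c k))\<^sup>2 * ?w k \<ge> 0" for k
    by (intro mult_nonneg_nonneg less_imp_le[OF hweight_pos]) auto
  have "sqrt (\<Sum>\<^sub>\<infinity>k. (cmod (?c k))\<^sup>2 * ?w k) \<le> 1"
    using f(2) hs by (simp add: hnorm_def)
  then have "(\<Sum>\<^sub>\<infinity>k. (cmod (?c k))\<^sup>2 * ?w k) \<le> 1" by simp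
  then have c1: "(\<Sum>k\<in>H. (cmod (?c k))\<^sup>2 * ?w k) \<le> 1" if "finite H" for H
    using finite_sum_le_infsum[OF summ that] nonneg by fastforce
  define D where "D k = lattice_coeff z M f k - ?c k" for k
  define X where "X k = {h. int M dvd zdot z h - zdot z k} - I" for k
  have D: "((\<lambda>h. if h \<in> X k then ?c h else 0) has_sum D k) UNIV" if k: "k \<in> I" for k
  proof -
    have "((\<lambda>h. if int M dvd zdot z h - zdot z k then ?c h else 0) has_sum lattice_coeff z M f k) UNIV"
      by (intro aliasing M fourier_series_has_sum cont per summable_fourier_coeff[OF params hs])
    moreover have "((\<lambda>h. if h = k then - ?c k else 0) has_sum - ?c k) UNIV"
      using has_sum_finite_neutralI[of "{k}" UNIV "\<lambda>h. if h = k then - ?c k else 0"] by simp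
    ultimately have "((\<lambda>h. (if int M dvd zdot z h - zdot z k then ?c h else 0) + (if h = k then - ?c k else 0)) has_sum D k) UNIV"
      using has_sum_add by (fastforce simp: D_def)
    \<comment> \<open>By reconstruction the coset of \<open>k\<close> meets \<open>I\<close> in
      \<open>k\<close> alone, so deleting \<open>I\<close> amounts to subtracting the coefficient at
      \<open>k\<close>.\<close>
    moreover have "(if int M dvd zdot z h - zdot z k then ?c h else 0) + (if h = k then - ?c k else 0) = (if h \<in> X k then ?c h else 0)" for h
      using reconstructing_distinct[OF rec I _ k, of h] k by (auto simp: X_def)
    ultimately show ?thesis by simp
  qed
  have dis: "disjoint_family_on X I"
    unfolding disjoint_family_on_def
  proof (intro ballI impI)
    fix k l assume kl: "k \<in> I" "l \<in> I" "k \<noteq> l"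
    have False if "h \<in> X k" "h \<in> X l" for h
    proof -
      have "int M dvd zdot z h - zdot z l" "int M dvd zdot z h - zdot z k"
        using that by (auto simp: X_def)
      then have "int M dvd (zdot z h - zdot z l) - (zdot z h - zdot z k)" by (rule dvd_diff)
      then have "int M dvd zdot z k - zdot z l" by simp
      then show False using reconstructing_distinct[OF rec I kl(1,2)] kl(3) by simp
    qed
    then show "X k \<inter> X l = {}" by blast
  qed
  have D1: "(\<Sum>k\<in>I. (cmod (D k))\<^sup>2) \<le> W"
    by (rule sum_coset_sq_le[OF I dis hweight_pos _ c1 D W(1)]) (auto simp: X_def intro: W(2))
  have g: "fourier_coeff (\<lambda>x. f x - sampling_op I z M f x) k = (if k \<in> I then - D k else ?c k)" for k
    using I by (simp add: sampling_op_def fourier_coeff_diff cont continuous_intros fourier_coeff_trig_poly D_def)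
  fix F :: "(int ^ 'n) set" assume F: "finite F"
  have "(\<Sum>k\<in>F. (cmod (fourier_coeff (\<lambda>x. f x - sampling_op I z M f x) k))\<^sup>2 * hweight \<gamma> 0 k)
      = (\<Sum>k\<in>F - I. (cmod (?c k))\<^sup>2 * hweight \<gamma> 0 k) + (\<Sum>k\<in>F \<inter> I. (cmod (D k))\<^sup>2 * hweight \<gamma> 0 k)"
    using F by (subst sum.Int_Diff[of F _ I]) (auto simp: g add.commute intro!: arg_cong2[where f = "(+)"] sum.cong)
  also have "(\<Sum>k\<in>F - I. (cmod (?c k))\<^sup>2 * hweight \<gamma> 0 k) \<le> (\<Sum>k\<in>F - I. A * ((cmod (?c k))\<^sup>2 * ?w k))"
  proof (rule sum_mono)
    fix k assume "k \<in> F - I"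
    then have "(cmod (?c k))\<^sup>2 * hweight \<gamma> 0 k \<le> (cmod (?c k))\<^sup>2 * (A * ?w k)"
      by (intro mult_left_mono A(2)) auto
    then show "(cmod (?c k))\<^sup>2 * hweight \<gamma> 0 k \<le> A * ((cmod (?c k))\<^sup>2 * ?w k)" by (simp add: mult_ac)
  qed
  also have "\<dots> = A * (\<Sum>k\<in>F - I. (cmod (?c k))\<^sup>2 * ?w k)" by (simp add: sum_distrib_left)
  also have "\<dots> \<le> A * 1" using F by (intro mult_left_mono A(1) c1) auto
  also have "(\<Sum>k\<in>F \<inter> I. (cmod (D k))\<^sup>2 * hweight \<gamma> 0 k) \<le> (\<Sum>k\<in>F \<inter> I. (cmod (D k))\<^sup>2 * V)"
    by (intro sum_mono mult_left_mono V(2)) auto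
  also have "\<dots> \<le> (\<Sum>k\<in>I. (cmod (D k))\<^sup>2 * V)" using I V by (intro sum_mono2) auto
  also have "\<dots> = V * (\<Sum>k\<in>I. (cmod (D k))\<^sup>2)" by (simp add: sum_distrib_left mult.commute)
  also have "\<dots> \<le> V * W" by (intro mult_left_mono D1 V(1))
  finally show "(\<Sum>k\<in>F. (cmod (fourier_coeff (\<lambda>x. f x - sampling_op I z M f x) k))\<^sup>2 * hweight \<gamma> 0 k) \<le> A + V * W"
    by simp
qed

text \<open>The difference of two coset points lies in the dual lattice. If it also lies in a box
  whose levels add up to the threshold, it belongs to the cross together with 0, so reconstruction
  forces it to be 0. This is the separation required for the cell count.\<close>

lemma card_coset_box_le:
  fixes z :: "int ^ 'n"
  assumes rec: "reconstructing (hyp_cross R) z M" and R: "R \<ge> 1"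
    and j: "cross_level TYPE('n) R \<le> (\<Sum>i\<in>UNIV. j i)"
  shows "real (card ({h. int M dvd zdot z h - t} \<inter> dyadic_box j))
    \<le> 3 ^ CARD('n) * 2 ^ (\<Sum>i\<in>UNIV. j i) / 2 ^ cross_level TYPE('n) R"
proof (rule card_separated_le[OF _ j])
  fix h h' l
  assume h: "h \<in> {h. int M dvd zdot z h - t}" "h' \<in> {h. int M dvd zdot z h - t}"
    and l: "(\<Sum>i\<in>UNIV. l i) = cross_level TYPE('n) R" and box: "h - h' \<in> dyadic_box l"
  have "h - h' \<in> hyp_cross R"
    using total_level_le_of_box[OF box] l by (simp add: hyp_cross_iff_nat[OF R])
  moreover have "(0 :: int ^ 'n) \<in> hyp_cross R"
    using total_level_le_of_box[of 0 "\<lambda>_::'n. 0"] by (simp add: hyp_cross_iff_nat[OF R] dyadic_box_def)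
  moreover have "int M dvd zdot z (h - h') - zdot z 0"
    using h dvd_diff[of "int M" "zdot z h - t" "zdot z h' - t"] by (simp add: zdot_diff)
  ultimately have "h - h' = 0"
    using reconstructing_distinct[OF rec finite_hyp_cross[OF R]] by blast
  then show "h = h'" by simp
qed

theorem sampling_error_upper_bound:
  fixes \<alpha> \<beta> \<gamma> :: real
  assumes d: "CARD('n::finite) \<ge> 2"
    and \<alpha>: "\<alpha> \<ge> 0" and \<beta>: "\<beta> \<le> 0" and \<gamma>: "\<gamma> \<ge> 0" and \<alpha>\<beta>: "\<alpha> + \<beta> > 1 / 2" "\<alpha> + \<beta> > \<gamma>"
  obtains c where "c > 0"
    "\<And>R (z :: int ^ 'n) M. R \<ge> 1 \<Longrightarrow> reconstructing (hyp_cross R) z M \<Longrightarrow>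
      sampling_error \<alpha> \<beta> \<gamma> R z M \<le> ennreal (c * (2 powr (- (\<alpha> + \<beta> - \<gamma>) * R)
                  * (if \<beta> = 0 then R powr ((real CARD('n) - 1) / 2) else 1)))"
proof -
  obtain C where C0: "C > 0" and C: "\<And>(F :: (int ^ 'n) set) r c. finite F \<Longrightarrow> 0 \<le> c \<Longrightarrow> (\<And>h. h \<in> F \<Longrightarrow> r \<le> total_level h) \<Longrightarrow>
      (\<And>j. r \<le> (\<Sum>i\<in>UNIV. j i) \<Longrightarrow> real (card (F \<inter> dyadic_box j)) \<le> c * 2 ^ (\<Sum>i\<in>UNIV. j i)) \<Longrightarrow>
      (\<Sum>h\<in>F. 1 / hweight \<alpha> \<beta> h)
        \<le> C * c * (2 * 4 powr - (\<alpha> + \<beta>)) ^ r * (if \<beta> = 0 then (real r + 1) ^ (CARD('n) - 1) else 1)"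
    using sum_inverse_hweight_le[OF \<alpha> \<beta> \<alpha>\<beta>(1)] by blast
  define \<tau> where "\<tau> = \<alpha> + \<beta> - \<gamma>"
  have \<tau>: "\<tau> > 0" using \<alpha>\<beta> by (simp add: \<tau>_def)
  let ?d = "CARD('n)"
  define A0 where "A0 = (4 powr \<tau>) ^ ?d"
  \<comment> \<open>Total levels in the cross may exceed \<open>R\<close>, but not
    \<open>R + d\<close>; the surplus accounts for
    \<open>4 powr (\<gamma> * real ?d)\<close>.\<close>
  define V0 where "V0 = (2 powr \<gamma>) ^ ?d * 4 powr (\<gamma> * real ?d)"
  define W0 where "W0 = C * 3 ^ ?d * (real ?d + 1) ^ (?d - 1)"
  have pos: "A0 > 0" "V0 > 0" "W0 > 0" using C0 by (auto simp: A0_def V0_def W0_def)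
  have npow: "(4 powr a) ^ N = 4 powr (a * real N)" for a :: real and N by (simp add: powr_powr flip: powr_realpow)
  show thesis
  proof (rule that[of "sqrt (A0 + V0 * W0)"])
    show "sqrt (A0 + V0 * W0) > 0" using pos by (simp add: add_pos_pos)
    fix R and z :: "int ^ 'n" and M
    assume R: "R \<ge> 1" and rec: "reconstructing (hyp_cross R) z M"
    let ?I = "hyp_cross R :: (int ^ 'n) set"
    define N where "N = cross_level TYPE('n) R"
    have N: "R \<le> real N" "real N \<le> R + real ?d - 1"
      using cross_level_bounds[OF R d] by (auto simp: N_def)
    \<comment> \<open>The square of the logarithmic factor in the claim; the root is taken at the
      end.\<close>
    define P where "P = (if \<beta> = 0 then R ^ (?d - 1) else 1)"
    have P: "P \<ge> 1" using R by (simp add: P_def)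
    have decay: "(4 powr - a) ^ N \<le> 4 powr (- a * R)" if "a \<ge> 0" for a :: real
      unfolding npow using that N by (intro powr_mono) (auto simp: mult_left_mono)
    define A where "A = A0 * 4 powr (- \<tau> * R)"
    define V where "V = V0 * 4 powr (\<gamma> * R)"
    define W where "W = W0 * 4 powr (- (\<alpha> + \<beta>) * R) * P"
    have Ale: "hweight \<gamma> 0 k \<le> A * hweight \<alpha> \<beta> k" if "k \<notin> ?I" for k :: "int ^ 'n"
    proof -
      have "N \<le> total_level k" using that by (simp add: hyp_cross_iff_nat[OF R] N_def)
      then have "(4 powr - \<tau>) ^ total_level k \<le> (4 powr - \<tau>) ^ N"
        using \<tau> powr_mono[of "- \<tau>" 0 4] by (intro power_decreasing) auto
      also have "\<dots> \<le> 4 powr (- \<tau> * R)" using \<tau> by (intro decay) auto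
      finally have le: "(4 powr - \<tau>) ^ total_level k \<le> 4 powr (- \<tau> * R)" .
      have "hweight \<gamma> 0 k \<le> A0 * (4 powr - \<tau>) ^ total_level k * hweight \<alpha> \<beta> k"
        unfolding A0_def \<tau>_def using \<beta> \<tau> by (intro weight_quotient_le) (auto simp: \<tau>_def)
      also have "\<dots> \<le> A * hweight \<alpha> \<beta> k"
        unfolding A_def using pos less_imp_le[OF hweight_pos[of \<alpha> \<beta> k]] le
        by (intro mult_right_mono mult_left_mono) auto
      finally show ?thesis .
    qed
    have Vle: "hweight \<gamma> 0 k \<le> V" if "k \<in> ?I" for k :: "int ^ 'n"
    proof -
      have "hweight \<gamma> 0 k \<le> (2 powr \<gamma>) ^ ?d * (4 powr \<gamma>) ^ total_level k"
        unfolding hweight_0 by (rule prod_weight_le[OF \<gamma>])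
      also have "(4 powr \<gamma>) ^ total_level k \<le> 4 powr (\<gamma> * (real ?d + R))"
      proof -
        have "real (total_level k) \<le> real N" using that by (simp add: hyp_cross_iff_nat[OF R] N_def)
        then show ?thesis unfolding npow using \<gamma> N by (intro powr_mono mult_left_mono) auto
      qed
      finally show ?thesis by (simp add: V_def V0_def ring_distribs powr_add mult.assoc mult_left_mono)
    qed
    have Wle: "(\<Sum>h\<in>H. 1 / hweight \<alpha> \<beta> h) \<le> W"
      if "k \<in> ?I" "finite H" "H \<subseteq> {h. int M dvd zdot z h - zdot z k} - ?I" for k H
    proof -
      have "(\<Sum>h\<in>H. 1 / hweight \<alpha> \<beta> h)
          \<le> C * (3 ^ ?d / 2 ^ N) * (2 * 4 powr - (\<alpha> + \<beta>)) ^ N * (if \<beta> = 0 then (real N + 1) ^ (?d - 1) else 1)"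
      proof (rule C[OF that(2)])
        show "N \<le> total_level h" if "h \<in> H" for h
          using that \<open>H \<subseteq> _\<close> by (auto simp: hyp_cross_iff_nat[OF R] N_def)
        fix j :: "'n \<Rightarrow> nat" assume j: "N \<le> (\<Sum>i\<in>UNIV. j i)"
        have "real (card (H \<inter> dyadic_box j)) \<le> real (card ({h. int M dvd zdot z h - zdot z k} \<inter> dyadic_box j))"
          using that(3) finite_dyadic_box[of j] by (intro of_nat_mono card_mono) auto
        also have "\<dots> \<le> 3 ^ ?d / 2 ^ N * 2 ^ (\<Sum>i\<in>UNIV. j i)"
          using card_coset_box_le[OF rec R, of j "zdot z k"] j by (simp add: N_def)
        finally show "real (card (H \<inter> dyadic_box j)) \<le> 3 ^ ?d / 2 ^ N * 2 ^ (\<Sum>i\<in>UNIV. j i)" .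
      qed simp
      \<comment> \<open>The sparsity factor \<open>1 / 2 ^ N\<close> of the coset cancels the growth
        \<open>2 ^ N\<close> of the block cardinalities.\<close>
      also have "\<dots> = C * 3 ^ ?d * (4 powr - (\<alpha> + \<beta>)) ^ N * (if \<beta> = 0 then (real N + 1) ^ (?d - 1) else 1)"
        by (simp add: power_mult_distrib)
      also have "\<dots> \<le> C * 3 ^ ?d * 4 powr (- (\<alpha> + \<beta>) * R) * ((real ?d + 1) ^ (?d - 1) * P)"
      proof (intro mult_mono)
        show "(4 powr - (\<alpha> + \<beta>)) ^ N \<le> 4 powr (- (\<alpha> + \<beta>) * R)" using \<alpha>\<beta> by (intro decay) auto
        have "real ?d * 1 \<le> real ?d * R" using R by (intro mult_left_mono) auto
        then have "real N + 1 \<le> (real ?d + 1) * R" using N unfolding distrib_right by linarith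
        then have "(real N + 1) ^ (?d - 1) \<le> ((real ?d + 1) * R) ^ (?d - 1)" by (intro power_mono) auto
        then show "(if \<beta> = 0 then (real N + 1) ^ (?d - 1) else 1) \<le> (real ?d + 1) ^ (?d - 1) * P"
          by (simp add: P_def power_mult_distrib)
      qed (use C0 in auto)
      also have "\<dots> = W" by (simp add: W_def W0_def)
      finally show ?thesis .
    qed
    have "A + V * W \<le> (A0 + V0 * W0) * (4 powr (- \<tau> * R) * P)"
    proof -
      \<comment> \<open>The growth of the target weight on the cross reduces the aliasing decay from
        \<open>\<alpha> + \<beta>\<close> to \<open>\<tau>\<close>, the rate of the truncation
        part.\<close>
      have "V * W = V0 * W0 * (4 powr (- \<tau> * R) * P)"
        by (simp add: V_def W_def \<tau>_def algebra_simps flip: powr_add)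
      moreover have "A \<le> A0 * (4 powr (- \<tau> * R) * P)"
        unfolding A_def using pos P by simp
      ultimately show ?thesis by (simp add: distrib_right)
    qed
    then have "sqrt (A + V * W) \<le> sqrt ((A0 + V0 * W0) * (4 powr (- \<tau> * R) * P))"
      by (rule real_sqrt_le_mono)
    also have "\<dots> = sqrt (A0 + V0 * W0) * (sqrt (4 powr (- \<tau> * R)) * sqrt P)"
      by (simp add: real_sqrt_mult)
    also have "sqrt (4 powr (- \<tau> * R)) = 2 powr (- \<tau> * R)"
    proof -
      have "(4::real) powr (- \<tau> * R) = (2 powr (- \<tau> * R))\<^sup>2"
        by (simp add: power2_eq_square flip: powr_mult)
      then show ?thesis by simp
    qed
    also have "sqrt P = (if \<beta> = 0 then R powr ((real ?d - 1) / 2) else 1)"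
    proof -
      have "sqrt (R ^ (?d - 1)) = (R powr real (?d - 1)) powr (1 / 2)"
        using R by (subst powr_realpow) (simp_all add: powr_half_sqrt)
      also have "\<dots> = R powr ((real ?d - 1) / 2)" using d by (simp add: powr_powr of_nat_diff)
      finally show ?thesis by (simp add: P_def)
    qed
    finally have le: "sqrt (A + V * W) \<le> sqrt (A0 + V0 * W0) * (2 powr (- \<tau> * R) * (if \<beta> = 0 then R powr ((real ?d - 1) / 2) else 1))" .
    have "sampling_error \<alpha> \<beta> \<gamma> R z M \<le> ennreal (sqrt (A + V * W))"
      unfolding sampling_error_def op_norm_def
    proof (rule SUP_least)
      fix f :: "real ^ 'n \<Rightarrow> complex" assume "f \<in> {f \<in> hspace_cont \<alpha> \<beta>. hnorm \<alpha> \<beta> f \<le> 1}"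
      then show "hmix_norm \<gamma> (\<lambda>x. f x - sampling_op (hyp_cross R) z M f x) \<le> ennreal (sqrt (A + V * W))"
        using pos P by (intro hnorm_error_le[OF \<alpha> \<beta> \<alpha>\<beta>(1) rec finite_hyp_cross[OF R]] Ale Vle Wle)
          (auto simp: A_def V_def W_def)
    qed
    also have "\<dots> \<le> ennreal (sqrt (A0 + V0 * W0) * (2 powr (- \<tau> * R) * (if \<beta> = 0 then R powr ((real ?d - 1) / 2) else 1)))"
      by (rule ennreal_leI[OF le])
    finally show "sampling_error \<alpha> \<beta> \<gamma> R z M \<le> ennreal (sqrt (A0 + V0 * W0) * (2 powr (- (\<alpha> + \<beta> - \<gamma>) * R)
                  * (if \<beta> = 0 then R powr ((real CARD('n) - 1) / 2) else 1)))" by (simp add: \<tau>_def)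
  qed
qed

section \<open>Lower bound\<close>

text \<open>With \<open>s\<close> the integer part of the root of \<open>M\<close>, there are
  \<open>(s + 1)^2 > M\<close> pairs with entries from 0 to \<open>s\<close>. Two of them have the
  same residue, and their difference is the required vector.\<close>

lemma pigeonhole_lattice:
  fixes a b :: int
  assumes "M > 0"
  obtains k l :: int where "k \<noteq> 0 \<or> l \<noteq> 0" "k\<^sup>2 \<le> int M" "l\<^sup>2 \<le> int M" "int M dvd k * a + l * b"
proof -
  define s where "s = nat \<lfloor>sqrt (real M)\<rfloor>"
  have s: "real s \<le> sqrt (real M)" "sqrt (real M) < real s + 1" by (auto simp: s_def)
  have "(real s)\<^sup>2 \<le> real M" using s(1) by (metis of_nat_0_le_iff power_mono real_sqrt_pow2)
  then have sM: "(int s)\<^sup>2 \<le> int M" by (metis of_nat_le_iff of_nat_power)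
  have "sqrt (real M) ^ 2 < (real s + 1) ^ 2" using s(2) by (intro power_strict_mono) auto
  then have "real M < real ((s + 1)\<^sup>2)" by (simp add: add.commute)
  then have Ms: "M < (s + 1)\<^sup>2" by (simp only: of_nat_less_iff)
  define S where "S = {0..int s} \<times> {0..int s}"
  define \<phi> where "\<phi> = (\<lambda>(x, y). (x * a + y * b) mod int M)"
  have "\<phi> ` S \<subseteq> {0..<int M}" using assms by (auto simp: \<phi>_def)
  then have "card (\<phi> ` S) \<le> M" using card_mono[of "{0..<int M}" "\<phi> ` S"] by simp
  moreover have "card S = (s + 1)\<^sup>2" by (simp add: S_def card_cartesian_product power2_eq_square nat_add_distrib)
  ultimately have "\<not> inj_on \<phi> S" using Ms by (metis card_image not_le)
  then obtain x y x' y' where xy: "(x, y) \<in> S" "(x', y') \<in> S" "(x, y) \<noteq> (x', y')" "\<phi> (x, y) = \<phi> (x', y')"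
    unfolding inj_on_def by auto
  have sq: "u\<^sup>2 \<le> int M" if "\<bar>u\<bar> \<le> int s" for u
  proof -
    have "u\<^sup>2 \<le> (int s)\<^sup>2" using that by (metis abs_le_square_iff abs_of_nat)
    then show ?thesis using sM by linarith
  qed
  show thesis
  proof (rule that[of "x - x'" "y - y'"])
    show "x - x' \<noteq> 0 \<or> y - y' \<noteq> 0" using xy(3) by auto
    show "(x - x')\<^sup>2 \<le> int M" "(y - y')\<^sup>2 \<le> int M" using xy(1,2) by (auto intro!: sq simp: S_def)
    have "int M dvd (x * a + y * b) - (x' * a + y' * b)"
      using xy(4) by (simp add: \<phi>_def mod_eq_dvd_iff)
    then show "int M dvd (x - x') * a + (y - y') * b" by (simp add: algebra_simps)
  qed
qed

text \<open>On an axis the isotropic and the mixed weight have the same base, so the exponents add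
  up. This is why \<open>\<alpha> + \<beta>\<close> governs the lower bound.\<close>

lemma hweight_axis: "hweight a b (axis i c) = (1 + (real_of_int c)\<^sup>2) powr (a + b)"
proof -
  have "(\<Sum>s\<in>UNIV. (real_of_int (axis i c $ s))\<^sup>2) = (\<Sum>s\<in>UNIV. if s = i then (real_of_int c)\<^sup>2 else 0)"
    by (rule sum.cong) (auto simp: axis_def)
  moreover have "(\<Prod>s\<in>UNIV. (1 + (real_of_int (axis i c $ s))\<^sup>2) powr a)
      = (\<Prod>s\<in>UNIV. if s = i then (1 + (real_of_int c)\<^sup>2) powr a else 1)"
    by (rule prod.cong) (auto simp: axis_def)
  ultimately show ?thesis by (simp add: hweight_def powr_add mult.commute)
qed

lemma hspace_cont_trig_poly:
  assumes "finite I"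
  shows "trig_poly I c \<in> hspace_cont a b"
    and "hnorm a b (trig_poly I c) = ennreal (sqrt (\<Sum>k\<in>I. (cmod (c k))\<^sup>2 * hweight a b k))"
proof -
  let ?f = "trig_poly I c"
  have s: "((\<lambda>k. (cmod (fourier_coeff ?f k))\<^sup>2 * hweight a b k) has_sum (\<Sum>k\<in>I. (cmod (c k))\<^sup>2 * hweight a b k)) UNIV"
    using assms by (intro has_sum_finite_neutralI[of I]) (auto simp: fourier_coeff_trig_poly)
  have "?f \<in> L2_torus"
    by (intro L2_torus_of_continuous continuous_intros periodic1_trig_poly)
  then have h: "?f \<in> hspace a b" using s by (auto simp: hspace_def summable_on_def)
  then show "?f \<in> hspace_cont a b" by (simp add: hspace_cont_def continuous_intros)
  show "hnorm a b ?f = ennreal (sqrt (\<Sum>k\<in>I. (cmod (c k))\<^sup>2 * hweight a b k))"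
    using h infsumI[OF s] by (simp add: hnorm_def)
qed

theorem sampling_error_lower_bound:
  fixes \<alpha> \<beta> \<gamma> :: real and z :: "int ^ 'n::finite"
  assumes d: "CARD('n) \<ge> 2" and \<gamma>: "\<gamma> \<ge> 0" and \<alpha>\<beta>: "\<alpha> + \<beta> > \<gamma>" and M: "M > 0"
  shows "ennreal (sqrt (2 powr - (\<alpha> + \<beta> - \<gamma>) / 2) * real M powr (- (\<alpha> + \<beta> - \<gamma>) / 2)) \<le> sampling_error \<alpha> \<beta> \<gamma> R z M"
proof -
  obtain i s :: 'n where "i \<noteq> s"
  proof -
    have "\<not> (\<forall>i s :: 'n. i = s)"
      using d card_le_Suc0_iff_eq[of "UNIV :: 'n set"] by auto
    then show ?thesis using that by blast
  qed
  obtain a b :: int where ab: "a \<noteq> 0 \<or> b \<noteq> 0" "a\<^sup>2 \<le> int M" "b\<^sup>2 \<le> int M" "int M dvd a * z $ i + b * z $ s"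
    using pigeonhole_lattice[OF M] by blast
  \<comment> \<open>Reversing the sign of \<open>b\<close> turns the divisibility into a congruence
    between \<open>k\<close> and \<open>l\<close>. Lying on different axes, they could coincide only
    if both entries were 0.\<close>
  define k l where "k = axis i a" and "l = axis s (- b)"
  have kl: "k \<noteq> l" using ab(1) \<open>i \<noteq> s\<close> by (auto simp: k_def l_def axis_def vec_eq_iff)
  have dvd: "int M dvd zdot z k - zdot z l" using ab(4) by (simp add: k_def l_def zdot_axis)
  \<comment> \<open>The larger of the two weight bases: it bounds both summands of \<open>w\<close>
    from above and is attained in one summand of \<open>v\<close>.\<close>
  define N where "N = max (1 + (real_of_int a)\<^sup>2) (1 + (real_of_int b)\<^sup>2)"
  have N1: "N \<ge> 1" by (simp add: N_def le_max_iff_disj)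
  have N2: "N \<le> 2 * real M"
  proof -
    have "(real_of_int a)\<^sup>2 \<le> real M" "(real_of_int b)\<^sup>2 \<le> real M"
      using ab(2,3) by (metis of_int_le_iff of_int_of_nat_eq of_int_power)+
    then show ?thesis using M by (simp add: N_def)
  qed
  define w where "w = hweight \<alpha> \<beta> k + hweight \<alpha> \<beta> l"
  have w0: "w > 0" by (simp add: w_def add_pos_pos hweight_pos)
  have w2: "w \<le> 2 * N powr (\<alpha> + \<beta>)"
  proof -
    have "(1 + (real_of_int a)\<^sup>2) powr (\<alpha> + \<beta>) \<le> N powr (\<alpha> + \<beta>)"
      "(1 + (real_of_int b)\<^sup>2) powr (\<alpha> + \<beta>) \<le> N powr (\<alpha> + \<beta>)"
      using \<gamma> \<alpha>\<beta> by (auto intro!: powr_mono2 simp: N_def)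
    then show ?thesis by (simp add: w_def k_def l_def hweight_axis)
  qed
  define v where "v = hweight \<gamma> 0 k + hweight \<gamma> 0 l"
  have v: "v \<ge> N powr \<gamma>"
    by (cases "1 + (real_of_int a)\<^sup>2 \<le> 1 + (real_of_int b)\<^sup>2") (auto simp: v_def k_def l_def hweight_axis N_def max_def)
  \<comment> \<open>Opposite signs make the two exponentials cancel at every node; division by
    \<open>sqrt w\<close> normalises the source norm to 1.\<close>
  define c :: "int ^ 'n \<Rightarrow> complex" where "c h = (if h = k then 1 else -1) / of_real (sqrt w)" for h
  let ?f = "trig_poly {k, l} c"
  have cmod_c: "(cmod (c h))\<^sup>2 = 1 / w" for h
    using w0 by (simp add: c_def norm_divide power_divide)
  have f1: "hnorm \<alpha> \<beta> ?f = 1"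
    using kl w0 by (simp add: hspace_cont_trig_poly(2) cmod_c w_def flip: add_divide_distrib)
  have "?f (lattice_node z M j) = 0" for j
    using kl fexp_lattice_node_cong[OF M dvd, of j] by (simp add: trig_poly_def c_def)
  then have "lattice_coeff z M ?f = (\<lambda>_. 0)" by (simp add: lattice_coeff_def fun_eq_iff)
  then have S0: "sampling_op (hyp_cross R) z M ?f = (\<lambda>_. 0)"
    by (simp add: sampling_op_def trig_poly_def fun_eq_iff)
  have "hmix_norm \<gamma> ?f = ennreal (sqrt (v / w))"
    using kl by (simp add: hspace_cont_trig_poly(2) cmod_c v_def add_divide_distrib)
  moreover have "hmix_norm \<gamma> (\<lambda>x. ?f x - sampling_op (hyp_cross R) z M ?f x) \<le> sampling_error \<alpha> \<beta> \<gamma> R z M"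
    unfolding sampling_error_def op_norm_def
    by (rule SUP_upper) (simp add: hspace_cont_trig_poly(1) f1)
  ultimately have "ennreal (sqrt (v / w)) \<le> sampling_error \<alpha> \<beta> \<gamma> R z M" by (simp add: S0)
  \<comment> \<open>The power of 2 in the constant comes from \<open>N \<le> 2 * real M\<close>, the
    division by 2 from the two summands of \<open>w\<close>.\<close>
  moreover have "sqrt (2 powr - (\<alpha> + \<beta> - \<gamma>) / 2) * real M powr (- (\<alpha> + \<beta> - \<gamma>) / 2) \<le> sqrt (v / w)"
  proof -
    have "real M powr (- (\<alpha> + \<beta> - \<gamma>) / 2) = sqrt (real M powr - (\<alpha> + \<beta> - \<gamma>))"
      by (simp add: powr_powr flip: powr_half_sqrt)
    then have "sqrt (2 powr - (\<alpha> + \<beta> - \<gamma>) / 2) * real M powr (- (\<alpha> + \<beta> - \<gamma>) / 2)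
        = sqrt ((2 * real M) powr - (\<alpha> + \<beta> - \<gamma>) / 2)"
      by (simp add: powr_mult flip: real_sqrt_mult)
    also have "\<dots> \<le> sqrt (v / w)"
    proof (rule real_sqrt_le_mono)
      have "(2 * real M) powr - (\<alpha> + \<beta> - \<gamma>) \<le> N powr - (\<alpha> + \<beta> - \<gamma>)"
        using N1 N2 \<alpha>\<beta> by (intro powr_mono2') auto
      also have "\<dots> = N powr \<gamma> / N powr (\<alpha> + \<beta>)" by (simp add: powr_diff[symmetric] algebra_simps)
      finally have "(2 * real M) powr - (\<alpha> + \<beta> - \<gamma>) / 2 \<le> N powr \<gamma> / (2 * N powr (\<alpha> + \<beta>))" by simp
      also have "\<dots> \<le> v / w" using v w2 w0 order_trans[OF powr_ge_zero v] by (intro frac_le) auto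
      finally show "(2 * real M) powr - (\<alpha> + \<beta> - \<gamma>) / 2 \<le> v / w" .
    qed
    finally show ?thesis .
  qed
  ultimately show ?thesis using ennreal_leI order_trans by blast
qed

section \<open>The difference set of the hyperbolic cross\<close>

lemma finite_bounded_total:
  assumes "finite B"
  shows "finite {m :: 'a \<Rightarrow> nat. m \<in> extensional B \<and> (\<Sum>s\<in>B. m s) \<le> N}"
proof (rule finite_subset)
  show "{m. m \<in> extensional B \<and> (\<Sum>s\<in>B. m s) \<le> N} \<subseteq> PiE B (\<lambda>_. {..N})"
  proof
    fix m :: "'a \<Rightarrow> nat" assume m: "m \<in> {m. m \<in> extensional B \<and> (\<Sum>s\<in>B. m s) \<le> N}"
    have "m s \<le> N" if "s \<in> B" for s
      using member_le_sum[OF that, of m] assms m by simp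
    then show "m \<in> PiE B (\<lambda>_. {..N})" using m by (auto simp: PiE_def)
  qed
qed (use assms in \<open>auto intro: finite_PiE\<close>)

text \<open>For each total \<open>n \<le> N\<close> there are at most
  \<open>(N + 1) ^ (card B - 1)\<close> vectors, and the geometric sum over \<open>n\<close> is
  dominated by its last term.\<close>

lemma sum_two_power_total_le:
  assumes B: "finite B" "B \<noteq> {}"
  shows "(\<Sum>m | m \<in> extensional B \<and> (\<Sum>s\<in>B. m s) \<le> N. 2 ^ (\<Sum>s\<in>B. m s))
    \<le> 2 * 2 ^ N * (real N + 1) ^ (card B - 1)"
proof -
  let ?W = "{m. m \<in> extensional B \<and> (\<Sum>s\<in>B. m s) \<le> N}"
  obtain i where i: "i \<in> B" using B by blast
  have fin: "finite ?W" by (rule finite_bounded_total[OF B(1)])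
  have "(\<Sum>m\<in>?W. 2 ^ (\<Sum>s\<in>B. m s)) = (\<Sum>n\<le>N. \<Sum>m | m \<in> ?W \<and> (\<Sum>s\<in>B. m s) = n. 2 ^ (\<Sum>s\<in>B. m s) :: real)"
    by (rule sum.group[symmetric]) (use fin in auto)
  also have "\<dots> \<le> (\<Sum>n\<le>N. 2 ^ n * (real N + 1) ^ (card B - 1))"
  proof (rule sum_mono)
    fix n assume n: "n \<in> {..N}"
    let ?J = "{m \<in> ?W. (\<Sum>s\<in>B. m s) = n}"
    have "real (card ?J) = (\<Sum>m\<in>?J. \<Prod>s\<in>B - {i}. (1 :: real))" by simp
    also have "\<dots> \<le> (\<Sum>a\<le>n. (1 :: real)) ^ (card B - 1)"
      by (rule sum_prod_fixed_total_le[OF B(1) i]) (use finite_subset[OF _ fin, of ?J] in auto)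
    also have "\<dots> \<le> (real N + 1) ^ (card B - 1)" using n by (intro power_mono) auto
    finally have "2 ^ n * real (card ?J) \<le> 2 ^ n * (real N + 1) ^ (card B - 1)" by simp
    then show "(\<Sum>m | m \<in> ?W \<and> (\<Sum>s\<in>B. m s) = n. 2 ^ (\<Sum>s\<in>B. m s)) \<le> 2 ^ n * (real N + 1) ^ (card B - 1)"
      by (simp add: mult.commute)
  qed
  also have "\<dots> = (\<Sum>n\<le>N. 2 ^ n) * (real N + 1) ^ (card B - 1)" by (simp add: sum_distrib_right)
  also have "\<dots> \<le> (2 * 2 ^ N) * (real N + 1) ^ (card B - 1)"
  proof (rule mult_right_mono)
    show "(\<Sum>n\<le>N. 2 ^ n) \<le> 2 * (2 ^ N :: real)" by (induction N) auto
  qed simp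
  finally show ?thesis .
qed

text \<open>The vector \<open>m\<close> is determined by its restrictions to \<open>A\<close> and to
  the complement, so the sum is at most a product of two sums. Each nonempty part saves one power of
  \<open>N + 1\<close>, which gives the exponent \<open>CARD('n) - 2\<close>.\<close>

lemma sum_two_power_split_le:
  fixes A :: "'n::finite set"
  assumes d: "CARD('n) \<ge> 2"
  shows "finite {m :: 'n \<Rightarrow> nat. (\<Sum>s\<in>A. m s) \<le> N \<and> (\<Sum>s\<in>-A. m s) \<le> N}"
    and "(\<Sum>m | (\<Sum>s\<in>A. m s) \<le> N \<and> (\<Sum>s\<in>-A. m s) \<le> N. 2 ^ (\<Sum>s\<in>UNIV. m s))
      \<le> 4 * 4 ^ N * (real N + 1) ^ (CARD('n) - 2)"
proof -
  let ?V = "{m :: 'n \<Rightarrow> nat. (\<Sum>s\<in>A. m s) \<le> N \<and> (\<Sum>s\<in>-A. m s) \<le> N}"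
  define W where "W B = {m :: 'n \<Rightarrow> nat. m \<in> extensional B \<and> (\<Sum>s\<in>B. m s) \<le> N}" for B
  define T where "T B = (\<Sum>m\<in>W B. (2::real) ^ (\<Sum>s\<in>B. m s))" for B
  have finW: "finite (W B)" for B unfolding W_def by (rule finite_bounded_total) simp
  define \<rho> where "\<rho> m = (restrict m A, restrict m (- A))" for m :: "'n \<Rightarrow> nat"
  have inj: "inj_on \<rho> ?V"
  proof (rule inj_onI)
    fix m m' assume "\<rho> m = \<rho> m'"
    then have "m s = m' s" for s
      by (cases "s \<in> A") (auto simp: \<rho>_def dest: fun_cong[where x = s])
    then show "m = m'" by blast
  qed
  have sub: "\<rho> ` ?V \<subseteq> W A \<times> W (- A)" by (auto simp: \<rho>_def W_def)
  then show "finite ?V" using finW inj by (meson finite_SigmaI finite_imageD finite_subset)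
  have split: "(\<Sum>s\<in>UNIV. m s) = (\<Sum>s\<in>A. m s) + (\<Sum>s\<in>-A. m s)" for m :: "'n \<Rightarrow> nat"
    using sum.subset_diff[of A UNIV m] by (simp add: Compl_eq_Diff_UNIV)
  have "(\<Sum>m\<in>?V. (2::real) ^ (\<Sum>s\<in>UNIV. m s)) = (\<Sum>m\<in>?V. (\<lambda>(p, q). 2 ^ (\<Sum>s\<in>A. p s) * 2 ^ (\<Sum>s\<in>-A. q s)) (\<rho> m))"
    by (simp add: \<rho>_def split power_add)
  also have "\<dots> = (\<Sum>(p, q)\<in>\<rho> ` ?V. 2 ^ (\<Sum>s\<in>A. p s) * 2 ^ (\<Sum>s\<in>-A. q s))"
    by (simp add: sum.reindex[OF inj])
  also have "\<dots> \<le> (\<Sum>(p, q)\<in>W A \<times> W (- A). 2 ^ (\<Sum>s\<in>A. p s) * 2 ^ (\<Sum>s\<in>-A. q s))"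
    using finW sub by (intro sum_mono2) auto
  also have "\<dots> = T A * T (- A)"
    by (simp add: T_def sum_product sum.cartesian_product)
  also have "\<dots> \<le> 4 * 4 ^ N * (real N + 1) ^ (CARD('n) - 2)"
  proof -
    have Tle: "T B \<le> 2 * 2 ^ N * (real N + 1) ^ (card B - 1)" if "B \<noteq> {}" for B
      unfolding T_def W_def by (rule sum_two_power_total_le) (use that in auto)
    have T0: "T {} = 1" by (simp add: T_def W_def)
    have Tpos: "T B \<ge> 0" for B by (auto simp: T_def intro: sum_nonneg)
    \<comment> \<open>If one part is empty, only one power is saved, but only one factor
      \<open>2 ^ N\<close> occurs; the missing one absorbs a factor \<open>N + 1\<close>.\<close>
    have full: "T UNIV \<le> 4 * 4 ^ N * (real N + 1) ^ (CARD('n) - 2)"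
    proof -
      have "real N + 1 \<le> 2 ^ N"
        using less_exp[of N] by (metis Suc_leI of_nat_Suc of_nat_le_iff of_nat_numeral of_nat_power add.commute)
      have "CARD('n) - 1 = Suc (CARD('n) - 2)" using d by simp
      then have "T UNIV \<le> 2 * 2 ^ N * ((real N + 1) * (real N + 1) ^ (CARD('n) - 2))"
        using Tle[of UNIV] by simp
      also have "\<dots> \<le> 2 * 2 ^ N * (2 ^ N * (real N + 1) ^ (CARD('n) - 2))"
        using \<open>real N + 1 \<le> 2 ^ N\<close> by (intro mult_left_mono mult_right_mono) auto
      also have "\<dots> = 2 * 4 ^ N * (real N + 1) ^ (CARD('n) - 2)"
        by (simp flip: power_mult_distrib)
      also have "\<dots> \<le> 4 * 4 ^ N * (real N + 1) ^ (CARD('n) - 2)" by (intro mult_right_mono) auto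
      finally show ?thesis .
    qed
    consider "A = {}" | "A = UNIV" | "A \<noteq> {}" "- A \<noteq> {}" by blast
    then show ?thesis
    proof cases
      case 3
      have "T A * T (- A) \<le> (2 * 2 ^ N * (real N + 1) ^ (card A - 1)) * (2 * 2 ^ N * (real N + 1) ^ (card (- A) - 1))"
        using 3 by (intro mult_mono Tle Tpos) auto
      also have "\<dots> = 4 * (2 ^ N * 2 ^ N) * ((real N + 1) ^ (card A - 1) * (real N + 1) ^ (card (- A) - 1))"
        by simp
      also have "\<dots> = 4 * 4 ^ N * (real N + 1) ^ ((card A - 1) + (card (- A) - 1))"
        by (simp add: power_add flip: power_mult_distrib)
      also have "(card A - 1) + (card (- A) - 1) = CARD('n) - 2"
      proof -
        have "card A + card (- A) = CARD('n)" using card_Un_disjoint[of A "- A"] by simp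
        moreover have "card A \<noteq> 0" "card (- A) \<noteq> 0" using 3 by auto
        ultimately show ?thesis by linarith
      qed
      finally show ?thesis .
    qed (use full T0 in auto)
  qed
  finally show "(\<Sum>m\<in>?V. 2 ^ (\<Sum>s\<in>UNIV. m s)) \<le> 4 * 4 ^ N * (real N + 1) ^ (CARD('n) - 2)" .
qed

text \<open>On \<open>A\<close> the larger level is that of \<open>k\<close>, elsewhere that of
  \<open>l\<close>, so each partial total is bounded by the total level of one member of the cross.
  The \<open>Suc\<close> allows for subtracting two entries of modulus at most
  \<open>2 ^ m i\<close>.\<close>

lemma difference_hyp_cross_subset:
  assumes R: "R \<ge> 1"
  shows "difference_set (hyp_cross R :: (int ^ 'n) set) \<subseteq>
    (\<Union>A. \<Union>m\<in>{m. (\<Sum>s\<in>A. m s) \<le> cross_level TYPE('n) R \<and> (\<Sum>s\<in>-A. m s) \<le> cross_level TYPE('n) R}. dyadic_box (\<lambda>i. Suc (m i)))"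
proof
  fix h :: "int ^ 'n" assume "h \<in> difference_set (hyp_cross R)"
  then obtain k l :: "int ^ 'n" where kl: "k \<in> hyp_cross R" "l \<in> hyp_cross R" "h = k - l"
    by (auto simp: difference_set_def)
  let ?N = "cross_level TYPE('n) R"
  define A where "A = {i. dlevel (l $ i) \<le> dlevel (k $ i)}"
  define m where "m i = max (dlevel (k $ i)) (dlevel (l $ i))" for i
  have sub: "(\<Sum>s\<in>B. dlevel (j $ s)) \<le> ?N" if "j \<in> hyp_cross R" for j :: "int ^ 'n" and B
  proof -
    have "(\<Sum>s\<in>B. dlevel (j $ s)) \<le> total_level j"
      unfolding total_level_def by (rule sum_mono2) auto
    then show ?thesis using that by (simp add: hyp_cross_iff_nat[OF R])
  qed
  have "(\<Sum>s\<in>A. m s) = (\<Sum>s\<in>A. dlevel (k $ s))" "(\<Sum>s\<in>-A. m s) = (\<Sum>s\<in>-A. dlevel (l $ s))"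
    by (auto simp: A_def m_def intro!: sum.cong)
  then have "(\<Sum>s\<in>A. m s) \<le> ?N" "(\<Sum>s\<in>-A. m s) \<le> ?N" using sub kl by simp_all
  moreover have "h \<in> dyadic_box (\<lambda>i. Suc (m i))"
  proof (clarsimp simp: dyadic_box_def)
    fix i
    have "\<bar>k $ i\<bar> \<le> 2 ^ m i" "\<bar>l $ i\<bar> \<le> 2 ^ m i"
      unfolding dlevel_le_iff[symmetric] by (simp_all add: m_def)
    then show "\<bar>h $ i\<bar> \<le> 2 * 2 ^ m i" by (simp add: kl(3))
  qed
  ultimately show "h \<in> (\<Union>A. \<Union>m\<in>{m. (\<Sum>s\<in>A. m s) \<le> ?N \<and> (\<Sum>s\<in>-A. m s) \<le> ?N}. dyadic_box (\<lambda>i. Suc (m i)))"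
    by blast
qed

text \<open>A union bound: there are \<open>2 ^ d\<close> choices of \<open>A\<close>, and the box
  constant \<open>3 ^ d\<close> together with \<open>2 ^ d\<close> from the increased levels gives
  \<open>6 ^ d\<close>, hence \<open>12 ^ d\<close>.\<close>

lemma card_difference_hyp_cross_le:
  assumes R: "R \<ge> 1" and d: "CARD('n::finite) \<ge> 2"
  shows "real (card (difference_set (hyp_cross R :: (int ^ 'n) set)))
    \<le> 4 * 12 ^ CARD('n) * 4 ^ cross_level TYPE('n) R * (real (cross_level TYPE('n) R) + 1) ^ (CARD('n) - 2)"
proof -
  let ?N = "cross_level TYPE('n) R" and ?d = "CARD('n)"
  define V where "V A = {m :: 'n \<Rightarrow> nat. (\<Sum>s\<in>A. m s) \<le> ?N \<and> (\<Sum>s\<in>-A. m s) \<le> ?N}" for A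
  have finV: "finite (V A)" for A unfolding V_def by (rule sum_two_power_split_le(1)[OF d])
  have "card (difference_set (hyp_cross R :: (int ^ 'n) set)) \<le> card (\<Union>A. \<Union>m\<in>V A. dyadic_box (\<lambda>i. Suc (m i)))"
    using difference_hyp_cross_subset[OF R, where ?'n = 'n] finV
    by (intro card_mono) (auto simp: V_def finite_dyadic_box)
  also have "\<dots> \<le> (\<Sum>A\<in>UNIV. card (\<Union>m\<in>V A. dyadic_box (\<lambda>i. Suc (m i))))"
    by (rule card_UN_le) simp
  also have "\<dots> \<le> (\<Sum>A\<in>UNIV. \<Sum>m\<in>V A. card (dyadic_box (\<lambda>i. Suc (m i))))"
    by (intro sum_mono card_UN_le finV)
  finally have "real (card (difference_set (hyp_cross R :: (int ^ 'n) set)))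
      \<le> (\<Sum>A\<in>UNIV. \<Sum>m\<in>V A. real (card (dyadic_box (\<lambda>i. Suc (m i)))))"
    unfolding of_nat_sum[symmetric] of_nat_le_iff .
  also have "\<dots> \<le> (\<Sum>A\<in>UNIV. \<Sum>m\<in>V A. 6 ^ ?d * 2 ^ (\<Sum>s\<in>UNIV. m s))"
  proof (intro sum_mono)
    fix A and m :: "'n \<Rightarrow> nat"
    have "real (card (dyadic_box (\<lambda>i. Suc (m i)))) \<le> 3 ^ ?d * 2 ^ (\<Sum>i\<in>UNIV. Suc (m i))"
      by (rule card_dyadic_box_le)
    also have "(\<Sum>i\<in>UNIV. Suc (m i)) = ?d + (\<Sum>i\<in>UNIV. m i)" by (simp only: Suc_eq_plus1_left sum.distrib) simp
    also have "3 ^ ?d * 2 ^ (?d + (\<Sum>i\<in>UNIV. m i)) = 6 ^ ?d * (2 ^ (\<Sum>s\<in>UNIV. m s) :: real)"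
      by (simp add: power_add flip: power_mult_distrib mult.assoc)
    finally show "real (card (dyadic_box (\<lambda>i. Suc (m i)))) \<le> 6 ^ ?d * 2 ^ (\<Sum>s\<in>UNIV. m s)" .
  qed
  also have "\<dots> = (\<Sum>A\<in>UNIV. 6 ^ ?d * (\<Sum>m\<in>V A. 2 ^ (\<Sum>s\<in>UNIV. m s)))"
    by (simp add: sum_distrib_left)
  also have "\<dots> \<le> (\<Sum>A\<in>(UNIV :: 'n set set). 6 ^ ?d * (4 * 4 ^ ?N * (real ?N + 1) ^ (?d - 2)))"
    unfolding V_def by (intro sum_mono mult_left_mono sum_two_power_split_le(2)[OF d]) auto
  also have "\<dots> = 2 ^ ?d * (6 ^ ?d * (4 * 4 ^ ?N * (real ?N + 1) ^ (?d - 2)))"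
    by (simp add: card_UNIV_set)
  also have "\<dots> = 4 * 12 ^ ?d * 4 ^ ?N * (real ?N + 1) ^ (?d - 2)"
    by (simp flip: power_mult_distrib mult.assoc)
  finally show ?thesis .
qed

text \<open>The cross contains the points \<open>0\<close> to \<open>2 ^ N\<close> on an axis, with
  \<open>N\<close> the threshold. Their \<open>2 ^ N + 1\<close> residues modulo \<open>M\<close>
  must be distinct.\<close>

lemma reconstructing_size_ge:
  fixes z :: "int ^ 'n"
  assumes rec: "reconstructing (hyp_cross R) z M" and R: "R \<ge> 1"
  shows "2 ^ cross_level TYPE('n) R < M"
proof -
  let ?N = "cross_level TYPE('n) R"
  have M: "M > 0" using rec by (simp add: reconstructing_def)
  obtain i :: 'n where True by simp
  have mem: "axis i c \<in> hyp_cross R" if "c \<in> {0..2 ^ ?N}" for c :: int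
  proof -
    have "dlevel 0 = 0" using dlevel_le_iff[of 0 0] by simp
    then have "total_level (axis i c) = (\<Sum>s\<in>UNIV. if s = i then dlevel c else 0)"
      unfolding total_level_def by (intro sum.cong) (auto simp: axis_def)
    also have "\<dots> = dlevel c" by simp
    also have "\<dots> \<le> ?N" using that by (simp add: dlevel_le_iff)
    finally show ?thesis by (simp add: hyp_cross_iff_nat[OF R])
  qed
  have "inj_on (\<lambda>c. c * z $ i mod int M) {0..2 ^ ?N}"
  proof (rule inj_onI)
    fix c c' :: int assume c: "c \<in> {0..2 ^ ?N}" "c' \<in> {0..2 ^ ?N}" "c * z $ i mod int M = c' * z $ i mod int M"
    then have "int M dvd zdot z (axis i c) - zdot z (axis i c')" by (simp add: zdot_axis mod_eq_dvd_iff)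
    then have "axis i c = axis i c'"
      using reconstructing_distinct[OF rec finite_hyp_cross[OF R] mem mem] c by blast
    then show "c = c'" by (auto simp: axis_eq_axis)
  qed
  moreover have "(\<lambda>c. c * z $ i mod int M) ` {0..2 ^ ?N} \<subseteq> {0..<int M}" using M by auto
  ultimately have "card {0..(2::int) ^ ?N} \<le> card {0..<int M}"
    by (intro card_inj_on_le) auto
  then show ?thesis by (simp add: nat_add_distrib nat_power_eq)
qed

text \<open>The bound \<open>M \<le> L * R ^ (d - 2) * 4 powr R\<close> is solved for
  \<open>4 powr R\<close> and raised to the power \<open>- \<tau> / 2\<close>. The remaining powers
  of \<open>R\<close> become powers of \<open>ln M\<close> through
  \<open>R * ln 2 \<le> ln M\<close>. The exponent \<open>e\<close> covers both cases of the
  logarithmic factor.\<close>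

theorem cbc_size_bound:
  fixes \<tau> e K :: real
  assumes d: "CARD('n::finite) \<ge> 2" and \<tau>: "\<tau> \<ge> 0" and e: "e \<ge> 0" and K: "K > 0"
  obtains c where "c > 0"
    "\<And>R (z :: int ^ 'n) M. R \<ge> 1 \<Longrightarrow> reconstructing (hyp_cross R) z M \<Longrightarrow> cbc_constructed K (hyp_cross R) z M \<Longrightarrow>
      2 powr (- \<tau> * R) * R powr e
        \<le> c * (real M powr (- \<tau> / 2) * ln (real M) powr ((real CARD('n) - 2) / 2 * \<tau>) * ln (real M) powr e)"
proof -
  let ?d = "CARD('n)"
  \<comment> \<open>Collects \<open>K\<close> and the constant of the cardinality bound after
    replacing the threshold \<open>N\<close> by \<open>R + d\<close> in the power of 4 and
    \<open>N + 1\<close> by \<open>(d + 1) * R\<close>.\<close>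
  define L where "L = K * (4 * 12 ^ ?d * 4 powr real ?d * (real ?d + 1) ^ (?d - 2))"
  define p where "p = (real ?d - 2) / 2 * \<tau>"
  have L: "L > 0" using K by (simp add: L_def)
  have p: "p \<ge> 0" using d \<tau> by (simp add: p_def)
  show thesis
  proof (rule that[of "L powr (\<tau> / 2) / (ln 2 powr p * ln 2 powr e)"])
    show "L powr (\<tau> / 2) / (ln 2 powr p * ln 2 powr e) > 0" using L by simp
    fix R and z :: "int ^ 'n" and M
    assume R: "R \<ge> 1" and rec: "reconstructing (hyp_cross R) z M" and cbc: "cbc_constructed K (hyp_cross R) z M"
    define N where "N = cross_level TYPE('n) R"
    have N: "R \<le> real N" "real N \<le> R + real ?d - 1"
      using cross_level_bounds[OF R d] by (auto simp: N_def)
    have M2: "2 ^ N < M" using reconstructing_size_ge[OF rec R] by (simp add: N_def)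
    then have M: "M > 0" by simp
    have "R * ln 2 \<le> real N * ln 2" using N by (intro mult_right_mono) auto
    also have "\<dots> = ln (2 ^ N)" by (simp add: ln_realpow)
    also have "\<dots> \<le> ln (real M)"
    proof -
      have "(2::real) ^ N \<le> real M" using M2 by (metis less_imp_le of_nat_le_iff of_nat_numeral of_nat_power)
      then show ?thesis using M by (subst ln_le_cancel_iff) auto
    qed
    finally have "R * ln 2 \<le> ln (real M)" .
    then have lnM: "R powr a \<le> ln (real M) powr a / ln 2 powr a" if "a \<ge> 0" for a
    proof -
      have "R powr a * ln 2 powr a = (R * ln 2) powr a" using R by (simp add: powr_mult)
      also have "\<dots> \<le> ln (real M) powr a" using \<open>R * ln 2 \<le> ln (real M)\<close> that R by (intro powr_mono2) auto
      finally show ?thesis by (simp add: pos_le_divide_eq)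
    qed
    have "real M \<le> K * real (card (difference_set (hyp_cross R :: (int ^ 'n) set)))"
      using cbc by (simp add: cbc_constructed_def)
    also have "\<dots> \<le> K * (4 * 12 ^ ?d * 4 ^ N * (real N + 1) ^ (?d - 2))"
      unfolding N_def using K by (intro mult_left_mono card_difference_hyp_cross_le[OF R d]) auto
    also have "\<dots> \<le> K * (4 * 12 ^ ?d * (4 powr real ?d * 4 powr R) * ((real ?d + 1) ^ (?d - 2) * R ^ (?d - 2)))"
    proof (intro mult_left_mono mult_mono)
      have "(4::real) ^ N = 4 powr real N" by (simp add: powr_realpow)
      also have "\<dots> \<le> 4 powr (real ?d + R)" using N by (intro powr_mono) auto
      finally show "(4::real) ^ N \<le> 4 powr real ?d * 4 powr R" by (simp add: powr_add)
      have "real ?d * 1 \<le> real ?d * R" using R by (intro mult_left_mono) auto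
      then have "real N + 1 \<le> (real ?d + 1) * R" using N unfolding distrib_right by linarith
      then have "(real N + 1) ^ (?d - 2) \<le> ((real ?d + 1) * R) ^ (?d - 2)" by (intro power_mono) auto
      then show "(real N + 1) ^ (?d - 2) \<le> (real ?d + 1) ^ (?d - 2) * R ^ (?d - 2)"
        by (simp add: power_mult_distrib)
    qed (use K in auto)
    also have "\<dots> = L * R ^ (?d - 2) * 4 powr R" by (simp add: L_def)
    finally have Mle: "real M / (L * R ^ (?d - 2)) \<le> 4 powr R"
      using L R by (simp add: pos_divide_le_eq mult.commute)
    have Rp: "(R ^ (?d - 2)) powr (\<tau> / 2) = R powr p"
    proof -
      have "(R ^ (?d - 2)) powr (\<tau> / 2) = (R powr real (?d - 2)) powr (\<tau> / 2)"
        using R by (subst powr_realpow) auto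
      also have "\<dots> = R powr p" using d by (simp add: powr_powr p_def of_nat_diff)
      finally show ?thesis .
    qed
    have "(2::real) powr (- \<tau> * R) = (4 powr R) powr (- (\<tau> / 2))"
    proof -
      have "(4::real) = 2 powr 2" by simp
      then have "(4 powr R) powr (- (\<tau> / 2)) = ((2 powr 2) powr R) powr (- (\<tau> / 2))" by simp
      then show ?thesis by (simp only: powr_powr) (simp add: mult.commute)
    qed
    also have "\<dots> \<le> (real M / (L * R ^ (?d - 2))) powr (- (\<tau> / 2))"
      using Mle \<tau> M L R by (intro powr_mono2') auto
    also have "\<dots> = real M powr (- \<tau> / 2) * (L powr (\<tau> / 2) * R powr p)"
      using M L R by (simp add: powr_divide powr_minus powr_mult Rp field_simps)
    finally have "2 powr (- \<tau> * R) * R powr e \<le> (real M powr (- \<tau> / 2) * (L powr (\<tau> / 2) * R powr p)) * R powr e"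
      by (intro mult_right_mono) auto
    also have "\<dots> \<le> (real M powr (- \<tau> / 2) * (L powr (\<tau> / 2) * (ln (real M) powr p / ln 2 powr p))) * (ln (real M) powr e / ln 2 powr e)"
      by (intro mult_mono mult_left_mono lnM p e) auto
    also have "\<dots> = L powr (\<tau> / 2) / (ln 2 powr p * ln 2 powr e) * (real M powr (- \<tau> / 2) * ln (real M) powr p * ln (real M) powr e)"
      by simp
    finally show "2 powr (- \<tau> * R) * R powr e
        \<le> L powr (\<tau> / 2) / (ln 2 powr p * ln 2 powr e) * (real M powr (- \<tau> / 2) * ln (real M) powr ((real CARD('n) - 2) / 2 * \<tau>) * ln (real M) powr e)"
      by (simp only: p_def)
  qed
qed

section \<open>Combining the bounds into the chain of estimates\<close>

theorem theorem4p4: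
  fixes \<alpha> \<beta> \<gamma> :: real
  assumes "CARD('n::finite) \<ge> 2"
    and "\<alpha> > 1 / 2" and "\<beta> \<le> 0" and "\<gamma> \<ge> 0" and "\<alpha> + \<beta> > max \<gamma> (1 / 2)"
  shows "(\<exists>c1>0. \<exists>c2>0. \<forall>R\<ge>1. \<forall>(z :: int ^ 'n) M.
            reconstructing (hyp_cross R) z M \<longrightarrow>
              ennreal (c1 * real M powr (- (\<alpha> + \<beta> - \<gamma>) / 2)) \<le> sampling_error \<alpha> \<beta> \<gamma> R z M \<and>
              sampling_error \<alpha> \<beta> \<gamma> R z M \<le>
                ennreal (c2 * (2 powr (- (\<alpha> + \<beta> - \<gamma>) * R)
                  * (if \<beta> = 0 then R powr ((real CARD('n) - 1) / 2) else 1))))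
       \<and> (\<forall>K>0. \<exists>c3>0. \<forall>R\<ge>1. \<forall>(z :: int ^ 'n) M.
            reconstructing (hyp_cross R) z M \<and> cbc_constructed K (hyp_cross R) z M \<longrightarrow>
              2 powr (- (\<alpha> + \<beta> - \<gamma>) * R)
                  * (if \<beta> = 0 then R powr ((real CARD('n) - 1) / 2) else 1)
              \<le> c3 * (real M powr (- (\<alpha> + \<beta> - \<gamma>) / 2)
                  * ln (real M) powr ((real CARD('n) - 2) / 2 * (\<alpha> + \<beta> - \<gamma>))
                  * (if \<beta> = 0 then ln (real M) powr ((real CARD('n) - 1) / 2) else 1)))"
proof -
  define \<tau> where "\<tau> = \<alpha> + \<beta> - \<gamma>"
  define e where "e = (if \<beta> = 0 then (real CARD('n) - 1) / 2 else 0)"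
  have \<tau>: "\<tau> > 0" and e: "e \<ge> 0" using assms by (auto simp: \<tau>_def e_def)
  have upper: "\<exists>c2>0. \<forall>R\<ge>1. \<forall>(z :: int ^ 'n) M. reconstructing (hyp_cross R) z M \<longrightarrow>
      sampling_error \<alpha> \<beta> \<gamma> R z M \<le>
        ennreal (c2 * (2 powr (- (\<alpha> + \<beta> - \<gamma>) * R) * (if \<beta> = 0 then R powr ((real CARD('n) - 1) / 2) else 1)))"
  proof -
    have "\<alpha> \<ge> 0" "\<alpha> + \<beta> > 1 / 2" "\<alpha> + \<beta> > \<gamma>" using assms by auto
    from sampling_error_upper_bound[OF assms(1) this(1) assms(3,4) this(2,3)]
    show ?thesis by metis
  qed
  have cbc: "\<exists>c3>0. \<forall>R\<ge>1. \<forall>(z :: int ^ 'n) M. reconstructing (hyp_cross R) z M \<and> cbc_constructed K (hyp_cross R) z M \<longrightarrow>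
      2 powr (- (\<alpha> + \<beta> - \<gamma>) * R) * (if \<beta> = 0 then R powr ((real CARD('n) - 1) / 2) else 1)
        \<le> c3 * (real M powr (- (\<alpha> + \<beta> - \<gamma>) / 2)
            * ln (real M) powr ((real CARD('n) - 2) / 2 * (\<alpha> + \<beta> - \<gamma>))
            * (if \<beta> = 0 then ln (real M) powr ((real CARD('n) - 1) / 2) else 1))" if K: "K > 0" for K
  proof -
    obtain c where c: "c > 0"
      "\<And>R (z :: int ^ 'n) M. R \<ge> 1 \<Longrightarrow> reconstructing (hyp_cross R) z M \<Longrightarrow> cbc_constructed K (hyp_cross R) z M \<Longrightarrow>
        2 powr (- \<tau> * R) * R powr e
          \<le> c * (real M powr (- \<tau> / 2) * ln (real M) powr ((real CARD('n) - 2) / 2 * \<tau>) * ln (real M) powr e)"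
      using cbc_size_bound[OF assms(1) less_imp_le[OF \<tau>] e K] by blast
    show ?thesis
    proof (intro exI[of _ c] conjI allI impI c(1))
      fix R and z :: "int ^ 'n" and M
      assume R: "1 \<le> R" and rec: "reconstructing (hyp_cross R) z M \<and> cbc_constructed K (hyp_cross R) z M"
      have "2 ^ cross_level TYPE('n) R < M" using reconstructing_size_ge R rec by blast
      moreover have "(1 :: nat) \<le> 2 ^ cross_level TYPE('n) R" by simp
      \<comment> \<open>Positivity of \<open>ln M\<close> matters because
        \<open>0 powr 0 = 0\<close>; with it, exponent 0 yields the factor 1 of the case
        \<open>\<beta> < 0\<close>.\<close>
      ultimately have "1 < M" by linarith
      then have "ln (real M) > 0" by simp
      then have if_e: "(if \<beta> = 0 then R powr ((real CARD('n) - 1) / 2) else 1) = R powr e"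
        "(if \<beta> = 0 then ln (real M) powr ((real CARD('n) - 1) / 2) else 1) = ln (real M) powr e"
        using R by (auto simp: e_def)
      show "2 powr (- (\<alpha> + \<beta> - \<gamma>) * R) * (if \<beta> = 0 then R powr ((real CARD('n) - 1) / 2) else 1)
        \<le> c * (real M powr (- (\<alpha> + \<beta> - \<gamma>) / 2)
            * ln (real M) powr ((real CARD('n) - 2) / 2 * (\<alpha> + \<beta> - \<gamma>))
            * (if \<beta> = 0 then ln (real M) powr ((real CARD('n) - 1) / 2) else 1))"
        unfolding if_e using c(2)[OF R conjunct1[OF rec] conjunct2[OF rec]] by (simp only: \<tau>_def)
    qed
  qed
  have lower: "ennreal (sqrt (2 powr - \<tau> / 2) * real M powr (- (\<alpha> + \<beta> - \<gamma>) / 2)) \<le> sampling_error \<alpha> \<beta> \<gamma> R z M"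
    if "reconstructing (hyp_cross R) z M" for R M and z :: "int ^ 'n"
    unfolding \<tau>_def using assms that by (intro sampling_error_lower_bound) (auto simp: reconstructing_def)
  obtain c2 where c2: "c2 > 0" "\<And>R (z :: int ^ 'n) M. R \<ge> 1 \<Longrightarrow> reconstructing (hyp_cross R) z M \<Longrightarrow>
      sampling_error \<alpha> \<beta> \<gamma> R z M \<le>
        ennreal (c2 * (2 powr (- (\<alpha> + \<beta> - \<gamma>) * R) * (if \<beta> = 0 then R powr ((real CARD('n) - 1) / 2) else 1)))"
    using upper by blast
  show ?thesis
  proof (intro conjI)
    show "\<exists>c1>0. \<exists>c2>0. \<forall>R\<ge>1. \<forall>(z :: int ^ 'n) M.
            reconstructing (hyp_cross R) z M \<longrightarrow>
              ennreal (c1 * real M powr (- (\<alpha> + \<beta> - \<gamma>) / 2)) \<le> sampling_error \<alpha> \<beta> \<gamma> R z M \<and>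
              sampling_error \<alpha> \<beta> \<gamma> R z M \<le>
                ennreal (c2 * (2 powr (- (\<alpha> + \<beta> - \<gamma>) * R)
                  * (if \<beta> = 0 then R powr ((real CARD('n) - 1) / 2) else 1)))"
      by (intro exI[of _ "sqrt (2 powr - \<tau> / 2)"] exI[of _ c2] conjI allI impI lower c2) simp_all
  qed (use cbc in blast)
qed

end
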